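(* Let $G=(V,E)$ be a directed unweighted graph whose $(s,t)$-max-flow has value $\lambda$. Then one can compute in polynomial time a family $\mathcal{B}$ of $2\lambda+1$ $(s,t)$-flows in $G$ such that for each edge $e\in E$, the family $\mathcal{B}$ contains an $(s,t)$-max-flow of $G-e$.
   Context: Edges have unit capacity (multigraphs allowed). $G-e$ is the graph obtained by deleting edge $e$. *)

theory Defs
  imports
    Complex_Main
    "HOL-Computational_Algebra.Polynomial"
    "Graph_Theory.Digraph"
begin

section \<open>Unit-capacity flows\<close>

text \<open>
  Multigraphs are the arc-labelled digraphs of the library, which may have parallel arcs and loops.
  A flow vanishes outside the arc set. Hence a flow of the graph with arc \<open>a\<close> deleted is
  a flow of the whole graph that does not use \<open>a\<close>, also when \<open>a\<close> joins
  \<open>s\<close> and \<open>t\<close> and is therefore not constrained by conservation.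
\<close>

definition st_flow :: "('a, 'b) pre_digraph \<Rightarrow> 'a \<Rightarrow> 'a \<Rightarrow> ('b \<Rightarrow> real) \<Rightarrow> bool" where
  "st_flow G s t f \<longleftrightarrow>
     (\<forall>a. a \<notin> arcs G \<longrightarrow> f a = 0) \<and>
     (\<forall>a \<in> arcs G. 0 \<le> f a \<and> f a \<le> 1) \<and>
     (\<forall>v \<in> verts G - {s, t}. (\<Sum>a \<in> in_arcs G v. f a) = (\<Sum>a \<in> out_arcs G v. f a))"

definition flow_value :: "('a, 'b) pre_digraph \<Rightarrow> 'a \<Rightarrow> ('b \<Rightarrow> real) \<Rightarrow> real" where
  "flow_value G s f = (\<Sum>a \<in> out_arcs G s. f a) - (\<Sum>a \<in> in_arcs G s. f a)"

definition st_max_flow :: "('a, 'b) pre_digraph \<Rightarrow> 'a \<Rightarrow> 'a \<Rightarrow> ('b \<Rightarrow> real) \<Rightarrow> bool" where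
  "st_max_flow G s t f \<longleftrightarrow>
     st_flow G s t f \<and> (\<forall>g. st_flow G s t g \<longrightarrow> flow_value G s g \<le> flow_value G s f)"


section \<open>Polynomial time\<close>

text \<open>
  The machine model is a first-order, call-by-value Lisp on binary trees (the language F of
  Jones, Computability and Complexity from a Programming Perspective). Every evaluation step
  costs one unit; a comparison of two trees costs in addition the sizes of both. As trees are
  immutable, a value is a pointer into a shared heap and copying it takes constant time, so
  polynomial time in this model agrees with polynomial time on Turing machines.
\<close>

datatype val = Leaf | Node val val

fun val_size :: "val \<Rightarrow> nat" where
  "val_size Leaf = 1"
| "val_size (Node u v) = Suc (val_size u + val_size v)"

text \<open>
  Variables are de Bruijn indices into the environment. \<open>Call f es\<close> runs the body of
  the \<open>f\<close>-th function in the environment that consists of its arguments only.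
\<close>

datatype expr =
    Var nat
  | LeafE
  | NodeE expr expr
  | LeftE expr
  | RightE expr
  | Equal expr expr
  | Cond expr expr expr
  | Bind expr expr
  | Call nat "expr list"

fun left_of :: "val \<Rightarrow> val" where
  "left_of Leaf = Leaf"
| "left_of (Node u v) = u"

fun right_of :: "val \<Rightarrow> val" where
  "right_of Leaf = Leaf"
| "right_of (Node u v) = v"

definition val_of_bool :: "bool \<Rightarrow> val" where
  "val_of_bool b = (if b then Node Leaf Leaf else Leaf)"

text \<open>
  \<open>eval fs env e v c\<close>: with function bodies \<open>fs\<close>, the expression
  \<open>e\<close> terminates in the environment \<open>env\<close> with value \<open>v\<close> at cost
  \<open>c\<close>.
\<close>

inductive eval :: "expr list \<Rightarrow> val list \<Rightarrow> expr \<Rightarrow> val \<Rightarrow> nat \<Rightarrow> bool"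
  and evals :: "expr list \<Rightarrow> val list \<Rightarrow> expr list \<Rightarrow> val list \<Rightarrow> nat \<Rightarrow> bool"
  for fs :: "expr list"
where
  eval_Var: "i < length env \<Longrightarrow> eval fs env (Var i) (env ! i) 1"
| eval_LeafE: "eval fs env LeafE Leaf 1"
| eval_NodeE: "eval fs env e1 u c1 \<Longrightarrow> eval fs env e2 v c2 \<Longrightarrow>
    eval fs env (NodeE e1 e2) (Node u v) (c1 + c2 + 1)"
| eval_Left: "eval fs env e v c \<Longrightarrow> eval fs env (LeftE e) (left_of v) (c + 1)"
| eval_Right: "eval fs env e v c \<Longrightarrow> eval fs env (RightE e) (right_of v) (c + 1)"
| eval_Equal: "eval fs env e1 u c1 \<Longrightarrow> eval fs env e2 v c2 \<Longrightarrow>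
    eval fs env (Equal e1 e2) (val_of_bool (u = v)) (c1 + c2 + val_size u + val_size v + 1)"
| eval_Cond_true: "eval fs env e u c1 \<Longrightarrow> u \<noteq> Leaf \<Longrightarrow> eval fs env e1 v c2 \<Longrightarrow>
    eval fs env (Cond e e1 e2) v (c1 + c2 + 1)"
| eval_Cond_false: "eval fs env e u c1 \<Longrightarrow> u = Leaf \<Longrightarrow> eval fs env e2 v c2 \<Longrightarrow>
    eval fs env (Cond e e1 e2) v (c1 + c2 + 1)"
| eval_Bind: "eval fs env e1 u c1 \<Longrightarrow> eval fs (u # env) e2 v c2 \<Longrightarrow>
    eval fs env (Bind e1 e2) v (c1 + c2 + 1)"
| eval_Call: "f < length fs \<Longrightarrow> evals fs env es us c1 \<Longrightarrow> eval fs us (fs ! f) v c2 \<Longrightarrow>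
    eval fs env (Call f es) v (c1 + c2 + 1)"
| evals_Nil: "evals fs env [] [] 0"
| evals_Cons: "eval fs env e u c1 \<Longrightarrow> evals fs env es us c2 \<Longrightarrow>
    evals fs env (e # es) (u # us) (c1 + c2)"

inductive_cases eval_elims:
  "eval fs env (Var i) v c"
  "eval fs env LeafE v c"
  "eval fs env (NodeE e1 e2) v c"
  "eval fs env (LeftE e) v c"
  "eval fs env (RightE e) v c"
  "eval fs env (Equal e1 e2) v c"
  "eval fs env (Cond e e1 e2) v c"
  "eval fs env (Bind e1 e2) v c"
  "eval fs env (Call f es) v c"

inductive_cases evals_elims:
  "evals fs env [] us c"
  "evals fs env (e # es) us c"

lemma eval_deterministic:
  "eval fs env e v c \<Longrightarrow> eval fs env e v' c' \<Longrightarrow> v = v' \<and> c = c'"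
  "evals fs env es us c \<Longrightarrow> evals fs env es us' c' \<Longrightarrow> us = us' \<and> c = c'"
  by (induction arbitrary: v' c' and us' c' rule: eval_evals.inducts)
    ((erule eval_elims evals_elims; metis One_nat_def Suc_eq_plus1)+)

text \<open>A program consists of its function bodies and a main expression, whose only variable is the input.\<close>

type_synonym program = "expr list \<times> expr"

definition computes_within :: "program \<Rightarrow> val \<Rightarrow> val \<Rightarrow> nat \<Rightarrow> bool" where
  "computes_within P x y T \<longleftrightarrow> (\<exists>c \<le> T. eval (fst P) [x] (snd P) y c)"


section \<open>Input and output format\<close>

text \<open>Binary notation, least significant bit first.\<close>

fun enc_nat :: "nat \<Rightarrow> val" where
  "enc_nat n = (if n = 0 then Leaf else Node (val_of_bool (odd n)) (enc_nat (n div 2)))"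

declare enc_nat.simps [simp del]

definition enc_int :: "int \<Rightarrow> val" where
  "enc_int k = Node (val_of_bool (k < 0)) (enc_nat (nat \<bar>k\<bar>))"

definition enc_rat :: "rat \<Rightarrow> val" where
  "enc_rat r = Node (enc_int (fst (quotient_of r))) (enc_int (snd (quotient_of r)))"

fun enc_list :: "('a \<Rightarrow> val) \<Rightarrow> 'a list \<Rightarrow> val" where
  "enc_list enc [] = Leaf"
| "enc_list enc (x # xs) = Node (enc x) (enc_list enc xs)"

text \<open>
  The input lists the vertices, the arcs together with their end points, and the two terminals;
  the lists \<open>vs\<close> and \<open>es\<close> enumerate the vertices and the arcs in some order.
  The output is a list of flows, each given as the table of its values on the arcs.
\<close>

definition enc_input :: "(nat, nat) pre_digraph \<Rightarrow> nat list \<Rightarrow> nat list \<Rightarrow> nat \<Rightarrow> nat \<Rightarrow> val" where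
  "enc_input G vs es s t =
     Node (enc_list enc_nat vs)
       (Node (enc_list (\<lambda>a. Node (enc_nat a) (Node (enc_nat (tail G a)) (enc_nat (head G a)))) es)
         (Node (enc_nat s) (enc_nat t)))"

definition enc_flows :: "nat list \<Rightarrow> (nat \<Rightarrow> rat) list \<Rightarrow> val" where
  "enc_flows es B = enc_list (\<lambda>f. enc_list (\<lambda>a. Node (enc_nat a) (enc_rat (f a))) es) B"

definition real_flow :: "('b \<Rightarrow> rat) \<Rightarrow> 'b \<Rightarrow> real" where
  "real_flow f = (\<lambda>a. of_rat (f a))"

definition enumerates :: "'a list \<Rightarrow> 'a set \<Rightarrow> bool" where
  "enumerates xs A \<longleftrightarrow> distinct xs \<and> set xs = A"

end

theory Submission
  imports Defs
begin

text \<open>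
  Let \<open>f\<close> be an integral maximum flow of value \<open>m\<close> and put \<open>k = m + 1\<close>. In the
  flow \<open>k * f\<close> reduce the load of every arc from \<open>k\<close> to \<open>m\<close> by rerouting along
  residual cycles that overload no other arc. Where this fails, the arc lies in a minimum cut. The
  result \<open>x\<close> has value \<open>k * m\<close> and is at most \<open>k\<close>, so it is a sum of \<open>k\<close>
  unit-capacity flows of value \<open>m\<close>: repeatedly split off an integral flow that saturates the
  arcs of full load and avoids the empty ones. An arc of load at most \<open>m\<close> is avoided by one of
  these \<open>m + 1\<close> maximum flows. Likewise \<open>(m - 1) * f\<close> is a sum of \<open>m\<close> flows of value
  \<open>m - 1\<close>, and every arc is avoided by one of them, which is optimal if the arc lies in a minimum cut.

  All three computations repair violated bounds on the arcs of a circulation by pushing one unit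
  along a residual cycle. If no cycle passes through a violated arc, the vertices that the search reaches
  form a cut certificate.
\<close>

section \<open>The program\<close>

text \<open>An arc lies on all of \<open>k\<close> unit-capacity integral flows exactly when their
  sum loads it with \<open>k\<close>, so the task is to lower loads rather than to choose flows. The
  number \<open>k = m + 1\<close> comes from the count at a failed reroute: the \<open>d\<close>
  arcs that leave the certificate carry at least \<open>k - 1\<close> units each and one of them
  carries \<open>k\<close>, while only \<open>k * m\<close> units cross. This excludes
  \<open>d > m\<close> as soon as \<open>k > m\<close>. For the arcs of minimum cuts no rerouting
  takes place, since all loads of \<open>(m - 1) * f\<close> are below \<open>m\<close> from the
  start. The sizes \<open>m + 1\<close> and \<open>m\<close> of the two families add up to
  \<open>2 * m + 1\<close>. Polynomial time requires no scaling: amounts never exceed the number of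
  arcs plus one, and each computation starts with a total violation linear in the number of arcs, so
  linearly many unit pushes suffice.\<close>

datatype cell = Cell (nm: val) (src: val) (dst: val) (amt: nat) (lo: nat) (hi: nat)

text \<open>Unary amounts make a unit push and a test for zero constant-time operations. The binary
  numbers of the input are only compared for equality.\<close>

definition unary :: "nat \<Rightarrow> val" where
  "unary n = (Node Leaf ^^ n) Leaf"

definition enc_cell :: "cell \<Rightarrow> val" where
  "enc_cell r = Node (nm r) (Node (Node (src r) (dst r))
     (Node (unary (amt r)) (Node (unary (lo r)) (unary (hi r)))))"

abbreviation (input) "nmE e \<equiv> LeftE e"
abbreviation (input) "endsE e \<equiv> LeftE (RightE e)"
abbreviation (input) "srcE e \<equiv> LeftE (endsE e)"
abbreviation (input) "dstE e \<equiv> RightE (endsE e)"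
abbreviation (input) "amtE e \<equiv> LeftE (RightE (RightE e))"
abbreviation (input) "loE e \<equiv> LeftE (RightE (RightE (RightE e)))"
abbreviation (input) "hiE e \<equiv> RightE (RightE (RightE (RightE e)))"
abbreviation (input) "oneE \<equiv> NodeE LeafE LeafE"
abbreviation (input) "cellE n p x l u \<equiv> NodeE n (NodeE p (NodeE x (NodeE l u)))"
text \<open>An output entry with clear sign bits and denominator one. Only the numerators 0 and 1
  occur.\<close>

abbreviation (input) "ratE e \<equiv> NodeE (NodeE LeafE e) (NodeE LeafE (NodeE oneE LeafE))"

abbreviation (input) "LESS \<equiv> 0 :: nat"
abbreviation (input) "LOOK \<equiv> Suc 0"
abbreviation (input) "EXTEND \<equiv> 2 :: nat"
abbreviation (input) "VISIT \<equiv> 3 :: nat"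
abbreviation (input) "PASS \<equiv> 4 :: nat"
abbreviation (input) "REACH \<equiv> 5 :: nat"
abbreviation (input) "PUSH \<equiv> 6 :: nat"
abbreviation (input) "FIND \<equiv> 7 :: nat"
abbreviation (input) "IMPROVE \<equiv> 8 :: nat"
abbreviation (input) "REPEAT \<equiv> 9 :: nat"
abbreviation (input) "SOLVE \<equiv> 10 :: nat"
abbreviation (input) "COUNT \<equiv> 11 :: nat"
abbreviation (input) "INIT \<equiv> 12 :: nat"
abbreviation (input) "SCALE \<equiv> 13 :: nat"
abbreviation (input) "BOUND \<equiv> 14 :: nat"
abbreviation (input) "SUBTRACT \<equiv> 15 :: nat"
abbreviation (input) "SHOW \<equiv> 16 :: nat"
abbreviation (input) "PEEL \<equiv> 17 :: nat"

text \<open>Every loop is a recursion along the right spine of an argument. Hence the cell list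
  itself can serve as fuel that counts iterations.\<close>

definition prog :: "expr list" where
  "prog =
   [\<comment> \<open>LESS a b\<close>
    Cond (Var 1) (Cond (Var 0) (Call LESS [RightE (Var 0), RightE (Var 1)]) oneE) LeafE,
    \<comment> \<open>LOOK key table\<close>
    Cond (Var 1)
      (Cond (Equal (Var 0) (LeftE (LeftE (Var 1)))) (LeftE (Var 1)) (Call LOOK [Var 0, RightE (Var 1)]))
      LeafE,
    \<comment> \<open>EXTEND p q dart table\<close>
    Cond (Call LOOK [Var 1, Var 3]) (Var 3)
      (Bind (Call LOOK [Var 0, Var 3])
        (Cond (Var 0) (NodeE (NodeE (Var 2) (NodeE (Var 3) (RightE (Var 0)))) (Var 4)) (Var 4))),
    \<comment> \<open>VISIT cell table\<close>
    Bind (Cond (Call LESS [amtE (Var 0), hiE (Var 0)])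
           (Call EXTEND [srcE (Var 0), dstE (Var 0), NodeE (nmE (Var 0)) oneE, Var 1]) (Var 1))
      (Cond (Call LESS [loE (Var 1), amtE (Var 1)])
           (Call EXTEND [dstE (Var 1), srcE (Var 1), NodeE (nmE (Var 1)) LeafE, Var 0]) (Var 0)),
    \<comment> \<open>PASS cells table\<close>
    Cond (Var 0) (Call PASS [RightE (Var 0), Call VISIT [LeftE (Var 0), Var 1]]) (Var 1),
    \<comment> \<open>REACH fuel cells table\<close>
    Cond (Var 0) (Call REACH [RightE (Var 0), Var 1, Call PASS [Var 1, Var 2]]) (Var 2),
    \<comment> \<open>PUSH cells path\<close>
    Cond (Var 0)
      (Bind (Call LOOK [nmE (LeftE (Var 0)), Var 1])
        (NodeE
          (cellE (nmE (LeftE (Var 1))) (endsE (LeftE (Var 1)))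
            (Cond (Var 0)
              (Cond (RightE (Var 0)) (NodeE LeafE (amtE (LeftE (Var 1)))) (RightE (amtE (LeftE (Var 1)))))
              (amtE (LeftE (Var 1))))
            (loE (LeftE (Var 1))) (hiE (LeftE (Var 1))))
          (Call PUSH [RightE (Var 1), Var 2])))
      LeafE,
    \<comment> \<open>FIND p q cells\<close>
    Call LOOK [Var 1, Call REACH [Var 2, Var 2, NodeE (NodeE (Var 0) LeafE) LeafE]],
    \<comment> \<open>IMPROVE candidates cells\<close>
    Cond (Var 0)
      (Bind (LeftE (Var 0))
        (Bind (Cond (Call LESS [amtE (Var 0), loE (Var 0)])
                (NodeE (NodeE (nmE (Var 0)) oneE) (Call FIND [dstE (Var 0), srcE (Var 0), Var 2]))
                (Cond (Call LESS [hiE (Var 0), amtE (Var 0)])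
                  (NodeE (NodeE (nmE (Var 0)) LeafE) (Call FIND [srcE (Var 0), dstE (Var 0), Var 2]))
                  LeafE))
          (Cond (RightE (Var 0))
            (Call PUSH [Var 3, NodeE (LeftE (Var 0)) (RightE (RightE (Var 0)))])
            (Call IMPROVE [RightE (Var 2), Var 3]))))
      (Var 1),
    \<comment> \<open>REPEAT fuel cells\<close>
    Cond (Var 0) (Call REPEAT [RightE (Var 0), Call IMPROVE [Var 1, Var 1]]) (Var 1),
    \<comment> \<open>SOLVE cells\<close>
    Call REPEAT [Var 0, Call REPEAT [Var 0, Var 0]],
    \<comment> \<open>COUNT list\<close>
    Cond (Var 0) (NodeE LeafE (Call COUNT [RightE (Var 0)])) LeafE,
    \<comment> \<open>INIT arcs\<close>
    Cond (Var 0)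
      (NodeE (cellE (LeftE (LeftE (Var 0))) (RightE (LeftE (Var 0))) LeafE LeafE oneE)
        (Call INIT [RightE (Var 0)]))
      LeafE,
    \<comment> \<open>SCALE cells factor bound\<close>
    Cond (Var 0)
      (NodeE
        (cellE (nmE (LeftE (Var 0))) (endsE (LeftE (Var 0)))
          (Cond (amtE (LeftE (Var 0))) (Var 1) LeafE) LeafE (Var 2))
        (Call SCALE [RightE (Var 0), Var 1, Var 2]))
      LeafE,
    \<comment> \<open>BOUND cells k\<close>
    Cond (Var 0)
      (NodeE
        (cellE (nmE (LeftE (Var 0))) (endsE (LeftE (Var 0))) LeafE
          (Cond (Call LESS [amtE (LeftE (Var 0)), Var 1]) LeafE oneE)
          (Cond (amtE (LeftE (Var 0))) oneE LeafE))
        (Call BOUND [RightE (Var 0), Var 1]))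
      LeafE,
    \<comment> \<open>SUBTRACT cells cells\<close>
    Cond (Var 0)
      (NodeE
        (cellE (nmE (LeftE (Var 0))) (endsE (LeftE (Var 0)))
          (Cond (amtE (LeftE (Var 1))) (RightE (amtE (LeftE (Var 0)))) (amtE (LeftE (Var 0))))
          (loE (LeftE (Var 0))) (hiE (LeftE (Var 0))))
        (Call SUBTRACT [RightE (Var 0), RightE (Var 1)]))
      LeafE,
    \<comment> \<open>SHOW cells\<close>
    Cond (Var 0)
      (NodeE
        (NodeE (nmE (LeftE (Var 0)))
          (Cond (amtE (LeftE (Var 0))) (ratE (NodeE oneE LeafE)) (ratE LeafE)))
        (Call SHOW [RightE (Var 0)]))
      LeafE,
    \<comment> \<open>PEEL k value cells ends rest\<close>
    Cond (Var 0)
      (Bind (RightE (Call SOLVE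
               [NodeE (cellE oneE (Var 3) LeafE (Var 1) (Var 1)) (Call BOUND [Var 2, Var 0])]))
        (NodeE (Call SHOW [Var 0])
          (Call PEEL [RightE (Var 1), Var 2, Call SUBTRACT [Var 3, Var 0], Var 4, Var 5])))
      (Var 4)]"

text \<open>In the innermost expression \<open>Var 0\<close> holds the arcs of the maximum flow,
  \<open>Var 1\<close> its value and \<open>Var 4\<close> the pair of \<open>t\<close> and
  \<open>s\<close>. \<open>PEEL\<close> puts its flows in front of its last argument, so the inner
  call produces the flows of smaller value.\<close>

definition main_expr :: expr where
  "main_expr =
    Bind (LeftE (RightE (Var 0)))
     (Bind (NodeE (RightE (RightE (RightE (Var 1)))) (LeftE (RightE (RightE (Var 1)))))
       (Bind (Cond (Equal (LeftE (Var 0)) (RightE (Var 0))) LeafE (NodeE LeafE (Call COUNT [Var 1])))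
         (Bind (Call SOLVE [NodeE (cellE oneE (Var 1) LeafE (Var 0) (Var 0)) (Call INIT [Var 2])])
           (Bind (amtE (LeftE (Var 0)))
             (Bind (RightE (Var 1))
               (Call PEEL [NodeE LeafE (Var 1), Var 1,
                  Call SOLVE [Call SCALE [Var 0, NodeE LeafE (Var 1), Var 1]], Var 4,
                  Call PEEL [Var 1, RightE (Var 1), Call SCALE [Var 0, RightE (Var 1), LeafE], Var 4,
                     LeafE]]))))))"

lemma length_prog: "length prog = 18" by (simp add: prog_def)

section \<open>Symbolic execution with exact costs\<close>

definition wp :: "val list \<Rightarrow> expr \<Rightarrow> (val \<Rightarrow> nat \<Rightarrow> bool) \<Rightarrow> bool" where
  "wp env e Q \<longleftrightarrow> (\<exists>v c. eval prog env e v c \<and> Q v c)"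

definition wps :: "val list \<Rightarrow> expr list \<Rightarrow> (val list \<Rightarrow> nat \<Rightarrow> bool) \<Rightarrow> bool" where
  "wps env es Q \<longleftrightarrow> (\<exists>us c. evals prog env es us c \<and> Q us c)"

definition wp_call :: "nat \<Rightarrow> val list \<Rightarrow> (val \<Rightarrow> nat \<Rightarrow> bool) \<Rightarrow> bool" where
  "wp_call f us Q \<longleftrightarrow> f < length prog \<and> wp us (prog ! f) Q"

text \<open>Inverting the big-step rules turns execution into rewriting, with the cost accumulated
  in the postcondition. A call stays opaque as \<open>wp_call\<close> until the specification of the
  callee resolves it.\<close>

lemma wp_simps:
  "wp env (Var i) Q \<longleftrightarrow> i < length env \<and> Q (env ! i) 1"
  "wp env LeafE Q \<longleftrightarrow> Q Leaf 1"
  "wp env (NodeE e1 e2) Q \<longleftrightarrow> wp env e1 (\<lambda>u c1. wp env e2 (\<lambda>v c2. Q (Node u v) (c1 + c2 + 1)))"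
  "wp env (LeftE e) Q \<longleftrightarrow> wp env e (\<lambda>u c. Q (left_of u) (c + 1))"
  "wp env (RightE e) Q \<longleftrightarrow> wp env e (\<lambda>u c. Q (right_of u) (c + 1))"
  "wp env (Equal e1 e2) Q \<longleftrightarrow> wp env e1 (\<lambda>u c1. wp env e2
     (\<lambda>v c2. Q (val_of_bool (u = v)) (c1 + c2 + val_size u + val_size v + 1)))"
  "wp env (Cond e e1 e2) Q \<longleftrightarrow> wp env e (\<lambda>u c1. if u = Leaf
     then wp env e2 (\<lambda>v c2. Q v (c1 + c2 + 1)) else wp env e1 (\<lambda>v c2. Q v (c1 + c2 + 1)))"
  "wp env (Bind e1 e2) Q \<longleftrightarrow> wp env e1 (\<lambda>u c1. wp (u # env) e2 (\<lambda>v c2. Q v (c1 + c2 + 1)))"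
  "wp env (Call f es) Q \<longleftrightarrow> wps env es (\<lambda>us c1. wp_call f us (\<lambda>v c2. Q v (c1 + c2 + 1)))"
  "wps env [] R \<longleftrightarrow> R [] 0"
  "wps env (e # es) R \<longleftrightarrow> wp env e (\<lambda>u c1. wps env es (\<lambda>us c2. R (u # us) (c1 + c2)))"
  unfolding wp_def wps_def wp_call_def
  by (auto elim!: eval_elims evals_elims split: if_splits) (force intro: eval_evals.intros)+

definition cost :: "nat \<Rightarrow> val list \<Rightarrow> nat" where
  "cost f us = (THE c. \<exists>v. eval prog us (prog ! f) v c)"

definition computes :: "nat \<Rightarrow> val list \<Rightarrow> val \<Rightarrow> nat \<Rightarrow> bool" where
  "computes f us v T \<longleftrightarrow> wp_call f us (\<lambda>w c. w = v \<and> c \<le> T)"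

lemma computes_iff_cost:
  "computes f us v T \<longleftrightarrow> f < length prog \<and> eval prog us (prog ! f) v (cost f us) \<and> cost f us \<le> T"
proof -
  have "cost f us = c" if "eval prog us (prog ! f) v c" for c
    unfolding cost_def using that eval_deterministic(1) by (intro the_equality) blast+
  then show ?thesis unfolding computes_def wp_call_def wp_def by auto
qed

text \<open>Evaluation is deterministic, so a postcondition has to be checked at a single value and
  cost. A verified call thus becomes a rewrite rule; its cost stays symbolic and is bounded
  afterwards by \<open>cost_computes\<close>.\<close>

lemma wp_call_computes: "computes f us v T \<Longrightarrow> wp_call f us Q \<longleftrightarrow> Q v (cost f us)"
  unfolding computes_iff_cost wp_call_def wp_def using eval_deterministic(1) by blast

lemma cost_computes: "computes f us v T \<Longrightarrow> cost f us \<le> T"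
  unfolding computes_iff_cost by blast

lemma computesI:
  "f < 18 \<Longrightarrow> wp us (prog ! f) (\<lambda>w c. w = v \<and> c \<le> T) \<Longrightarrow> computes f us v T"
  by (simp add: computes_def wp_call_def length_prog)

lemma computes_mono: "computes f us v T \<Longrightarrow> T \<le> T' \<Longrightarrow> computes f us v T'"
  unfolding computes_iff_cost by auto

lemma unary_simps [simp]: "unary 0 = Leaf" "unary (Suc n) = Node Leaf (unary n)"
  by (simp_all add: unary_def)

lemma unary_eq_Leaf [simp]: "unary n = Leaf \<longleftrightarrow> n = 0"
  by (cases n) auto

lemma right_of_unary [simp]: "right_of (unary n) = unary (n - 1)"
  by (cases n) auto

lemma val_of_bool_eq_Leaf [simp]: "val_of_bool b = Leaf \<longleftrightarrow> \<not> b"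
  by (simp add: val_of_bool_def)

text \<open>Both numerals shrink in step, so the recursion ends with the shorter one.\<close>

lemma less_computes:
  "computes LESS [unary a, unary b] (val_of_bool (a < b)) (20 * (min a b + 1))"
proof (induction a arbitrary: b)
  case 0
  show ?case
    by (rule computesI) (auto simp: prog_def wp_simps val_of_bool_def)
next
  case (Suc a)
  show ?case
  proof (cases b)
    case 0
    then show ?thesis by (intro computesI) (auto simp: prog_def wp_simps val_of_bool_def)
  next
    case (Suc b')
    show ?thesis
      using wp_call_computes[OF Suc.IH[of b']] cost_computes[OF Suc.IH[of b']] unfolding Suc
      by (intro computesI) (auto simp: prog_def wp_simps)
  qed
qed

section \<open>What the program computes\<close>

text \<open>The flag is the direction of a push: \<open>True\<close> adds a unit to the named arc,
  \<open>False\<close> removes one. A table stores for each reached vertex a path to it, last dart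
  first.\<close>

type_synonym dart = "val \<times> bool"
type_synonym table = "(val \<times> dart list) list"

definition extend :: "val \<Rightarrow> val \<Rightarrow> dart \<Rightarrow> table \<Rightarrow> table" where
  "extend p q d R =
     (if map_of R q \<noteq> None then R
      else case map_of R p of None \<Rightarrow> R | Some path \<Rightarrow> (q, d # path) # R)"

definition visit :: "cell \<Rightarrow> table \<Rightarrow> table" where
  "visit r R =
     (let R' = (if amt r < hi r then extend (src r) (dst r) (nm r, True) R else R)
      in if lo r < amt r then extend (dst r) (src r) (nm r, False) R' else R')"

definition pass :: "cell list \<Rightarrow> table \<Rightarrow> table" where
  "pass X R = fold visit X R"

definition reach :: "nat \<Rightarrow> cell list \<Rightarrow> table \<Rightarrow> table" where
  "reach n X R = (pass X ^^ n) R"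

definition find_path :: "val \<Rightarrow> val \<Rightarrow> cell list \<Rightarrow> dart list option" where
  "find_path p q X = map_of (reach (length X) X [(p, [])]) q"

definition with_amt :: "cell \<Rightarrow> nat \<Rightarrow> cell" where
  "with_amt r x = Cell (nm r) (src r) (dst r) x (lo r) (hi r)"

definition adjust :: "dart list \<Rightarrow> cell \<Rightarrow> cell" where
  "adjust path r =
     (case map_of path (nm r) of None \<Rightarrow> r
      | Some b \<Rightarrow> with_amt r (if b then Suc (amt r) else amt r - 1))"

definition push :: "cell list \<Rightarrow> dart list \<Rightarrow> cell list" where
  "push X path = map (adjust path) X"

definition repair :: "cell \<Rightarrow> cell list \<Rightarrow> dart list option" where
  "repair r X =
     (if amt r < lo r then map_option (Cons (nm r, True)) (find_path (dst r) (src r) X)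
      else if hi r < amt r then map_option (Cons (nm r, False)) (find_path (src r) (dst r) X)
      else None)"

fun improve :: "cell list \<Rightarrow> cell list \<Rightarrow> cell list" where
  "improve [] X = X"
| "improve (r # Y) X = (case repair r X of None \<Rightarrow> improve Y X | Some path \<Rightarrow> push X path)"

definition repeat :: "nat \<Rightarrow> cell list \<Rightarrow> cell list" where
  "repeat n X = ((\<lambda>X. improve X X) ^^ n) X"

text \<open>Every successful improvement lowers the total violation by at least one. In all uses
  this total is initially at most twice the number of cells, hence two rounds with the cell list as
  fuel.\<close>

definition solve :: "cell list \<Rightarrow> cell list" where
  "solve X = repeat (length X) (repeat (length X) X)"

lemma with_amt_sel [simp]:
  "nm (with_amt r x) = nm r" "src (with_amt r x) = src r" "dst (with_amt r x) = dst r"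
  "amt (with_amt r x) = x" "lo (with_amt r x) = lo r" "hi (with_amt r x) = hi r"
  by (simp_all add: with_amt_def)

section \<open>Residual search\<close>

text \<open>Excluding \<open>q = p\<close> for nonempty walks means that no dart returns to the
  origin. This later keeps a violated arc off the path that closes its cycle.\<close>

fun walk :: "cell list \<Rightarrow> val \<Rightarrow> dart list \<Rightarrow> val \<Rightarrow> bool" where
  "walk X p [] q \<longleftrightarrow> q = p"
| "walk X p ((n, b) # path) q \<longleftrightarrow> q \<noteq> p \<and> (\<exists>r \<in> set X. nm r = n \<and>
     (if b then dst r = q \<and> amt r < hi r \<and> walk X p path (src r)
      else src r = q \<and> lo r < amt r \<and> walk X p path (dst r)))"

abbreviation keys :: "table \<Rightarrow> val set" where
  "keys R \<equiv> fst ` set R"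

abbreviation inside :: "cell \<Rightarrow> val set \<Rightarrow> bool" where
  "inside r S \<equiv> src r \<in> S \<and> dst r \<in> S"

definition traced :: "cell list \<Rightarrow> val \<Rightarrow> table \<Rightarrow> bool" where
  "traced X p R \<longleftrightarrow> p \<in> keys R \<and> (\<forall>(v, path) \<in> set R. walk X p path v \<and> distinct (map fst path) \<and>
     (\<forall>d \<in> set path. \<exists>r \<in> set X. nm r = fst d \<and> inside r (keys R)))"

lemma keys_extend_mono: "keys R \<subseteq> keys (extend p q d R)"
  by (auto simp: extend_def split: option.splits)

lemma keys_extend: "keys (extend p q d R) = (if p \<in> keys R then insert q (keys R) else keys R)"
  by (auto simp: extend_def map_of_eq_None_iff split: option.splits dest: map_of_SomeD)
    (metis map_of_eq_None_iff option.distinct(1) option.exhaust)+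

text \<open>
  A dart is added only if it ends at a new vertex, while all earlier darts join old vertices.
  Hence no arc occurs twice on a path.
\<close>

lemma traced_extend:
  assumes "traced X p R" "inj_on nm (set X)" "r \<in> set X"
    and "if b then u = src r \<and> v = dst r \<and> amt r < hi r else u = dst r \<and> v = src r \<and> lo r < amt r"
  shows "traced X p (extend u v (nm r, b) R)"
proof (cases "map_of R v = None \<and> map_of R u \<noteq> None")
  case False
  then show ?thesis using assms(1) by (auto simp: extend_def split: option.splits)
next
  case True
  then obtain path where path: "map_of R u = Some path" by auto
  have v: "v \<notin> keys R" using True by (simp add: map_of_eq_None_iff)
  have upath: "(u, path) \<in> set R" using path by (rule map_of_SomeD)
  have R: "p \<in> keys R" "\<And>w path'. (w, path') \<in> set R \<Longrightarrow> walk X p path' w \<and> distinct (map fst path') \<and>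
     (\<forall>d \<in> set path'. \<exists>r \<in> set X. nm r = fst d \<and> inside r (keys R))"
    using assms(1) by (auto simp: traced_def)
  have "nm r \<notin> fst ` set path"
  proof
    assume "nm r \<in> fst ` set path"
    then obtain r' where "r' \<in> set X" "nm r' = nm r" "inside r' (keys R)" using R(2)[OF upath] by force
    then have "inside r (keys R)" using assms(2,3) by (metis inj_onD)
    then show False using v assms(4) by (auto split: if_splits)
  qed
  moreover have "walk X p ((nm r, b) # path) v"
    using R(1) R(2)[OF upath] v assms(3,4) by (auto split: if_splits)
  moreover have "inside r (keys ((v, (nm r, b) # path) # R))"
    using upath assms(4) by (force split: if_splits)
  ultimately have new: "walk X p ((nm r, b) # path) v" "nm r \<notin> fst ` set path"
    "inside r (keys ((v, (nm r, b) # path) # R))" by blast+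
  let ?R = "(v, (nm r, b) # path) # R"
  have mono: "inside r' (keys R) \<Longrightarrow> inside r' (keys ?R)" for r' by simp
  have all: "walk X p path' w \<and> distinct (map fst path') \<and>
     (\<forall>d \<in> set path'. \<exists>r \<in> set X. nm r = fst d \<and> inside r (keys ?R))" if "(w, path') \<in> set ?R" for w path'
  proof (cases "(w, path') \<in> set R")
    case True
    show ?thesis using R(2)[OF True] mono by meson
  next
    case False
    then have w: "w = v" "path' = (nm r, b) # path" using that by auto
    have "\<exists>r \<in> set X. nm r = fst d \<and> inside r (keys ?R)" if "d \<in> set path'" for d
    proof (cases "d = (nm r, b)")
      case True
      then show ?thesis using new(3) assms(3) by (intro bexI[of _ r]) simp_all
    next
      case False
      then have "d \<in> set path" using that w by simp
      then show ?thesis using R(2)[OF upath] mono by meson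
    qed
    moreover have "walk X p path' w" "distinct (map fst path')"
      using new(1,2) R(2)[OF upath] w by simp_all
    ultimately show ?thesis by blast
  qed
  have "traced X p ?R"
    unfolding traced_def
  proof (intro conjI ballI)
    show "p \<in> keys ?R" using R(1) by simp
    fix z assume z: "z \<in> set ?R"
    obtain w path' where zw: "z = (w, path')" by (cases z)
    show "case z of (w, path') \<Rightarrow> walk X p path' w \<and> distinct (map fst path') \<and>
     (\<forall>d \<in> set path'. \<exists>r \<in> set X. nm r = fst d \<and> inside r (keys ?R))"
      using z unfolding zw prod.case by (rule all)
  qed
  then show ?thesis using True path by (simp add: extend_def)
qed

lemma traced_visit:
  assumes "traced X p R" "inj_on nm (set X)" "r \<in> set X"
  shows "traced X p (visit r R)"
  using assms by (auto simp: visit_def Let_def intro!: traced_extend)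

lemma traced_fold_visit:
  "traced X p R \<Longrightarrow> inj_on nm (set X) \<Longrightarrow> set Y \<subseteq> set X \<Longrightarrow> traced X p (fold visit Y R)"
  by (induction Y arbitrary: R) (auto intro: traced_visit)

lemma traced_reach:
  assumes "inj_on nm (set X)"
  shows "traced X p (reach n X [(p, [])])"
proof (induction n)
  case 0
  show ?case by (simp add: reach_def traced_def)
next
  case (Suc n)
  then show ?case using assms by (simp add: reach_def pass_def traced_fold_visit)
qed

text \<open>No residual dart of the arc leaves \<open>S\<close>. Inequalities are used because an
  amount may lie outside its bounds.\<close>

definition closed_under :: "val set \<Rightarrow> cell \<Rightarrow> bool" where
  "closed_under S r \<longleftrightarrow>
     (src r \<in> S \<longrightarrow> dst r \<notin> S \<longrightarrow> hi r \<le> amt r) \<and> (dst r \<in> S \<longrightarrow> src r \<notin> S \<longrightarrow> amt r \<le> lo r)"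

lemma keys_visit_mono: "keys R \<subseteq> keys (visit r R)"
  unfolding visit_def Let_def using keys_extend_mono by (simp, fast)

lemma keys_fold_visit_mono: "keys R \<subseteq> keys (fold visit Y R)"
proof (induction Y arbitrary: R)
  case (Cons r Y)
  have "keys R \<subseteq> keys (visit r R)" by (rule keys_visit_mono)
  also have "\<dots> \<subseteq> keys (fold visit Y (visit r R))" by (rule Cons.IH)
  finally show ?case unfolding fold.simps comp_apply .
qed simp

lemma keys_visit_cases:
  "keys (visit r R) = keys R \<and> closed_under (keys R) r \<or> inside r (keys (visit r R)) \<and> \<not> inside r (keys R)"
  by (auto simp: visit_def Let_def keys_extend closed_under_def)

lemma fold_visit_cases:
  "keys (fold visit Y R) = keys R \<and> (\<forall>r \<in> set Y. closed_under (keys R) r) \<or>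
   (\<exists>r \<in> set Y. inside r (keys (fold visit Y R)) \<and> \<not> inside r (keys R))"
proof (induction Y arbitrary: R)
  case (Cons r Y)
  consider "keys (visit r R) = keys R" "closed_under (keys R) r"
    | "inside r (keys (visit r R))" "\<not> inside r (keys R)"
    using keys_visit_cases by blast
  then show ?case
  proof cases
    case 1
    then show ?thesis using Cons.IH[of "visit r R"] by auto
  next
    case 2
    then show ?thesis using keys_fold_visit_mono[of "visit r R" Y] by auto
  qed
qed simp

lemma keys_fold_visit_closed:
  "\<forall>r \<in> set Y. closed_under (keys R) r \<Longrightarrow> keys (fold visit Y R) = keys R"
proof (induction Y arbitrary: R)
  case (Cons r Y)
  have "keys (visit r R) = keys R"
    using Cons.prems by (auto simp: visit_def Let_def keys_extend closed_under_def)
  then show ?case using Cons by simp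
qed simp

text \<open>Progress is counted in arcs with both ends reached, since the cells carry no list of
  vertices. A pass over a set that is not closed brings at least one more arc inside.\<close>

lemma reach_closed_or_many_inside:
  "(\<forall>r \<in> set X. closed_under (keys (reach n X R)) r) \<or>
   n \<le> card {r \<in> set X. inside r (keys (reach n X R))}"
proof (induction n)
  case (Suc n)
  let ?K = "keys (reach n X R)" and ?K' = "keys (reach (Suc n) X R)"
  have Suc_n: "reach (Suc n) X R = fold visit X (reach n X R)" by (simp add: reach_def pass_def)
  show ?case
  proof (cases "\<forall>r \<in> set X. closed_under ?K r")
    case True
    then show ?thesis using keys_fold_visit_closed[OF True] by (simp add: Suc_n)
  next
    case False
    then obtain r where "r \<in> set X" "inside r ?K'" "\<not> inside r ?K"
      using fold_visit_cases[of X "reach n X R"] unfolding Suc_n by blast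
    then have "{r \<in> set X. inside r ?K} \<subset> {r \<in> set X. inside r ?K'}"
      using keys_fold_visit_mono[of "reach n X R" X] unfolding Suc_n by blast
    then have "card {r \<in> set X. inside r ?K} < card {r \<in> set X. inside r ?K'}"
      by (intro psubset_card_mono) auto
    then show ?thesis using Suc False by linarith
  qed
qed simp

lemma reach_closed:
  assumes "r \<in> set X"
  shows "closed_under (keys (reach (length X) X R)) r"
proof -
  let ?K = "keys (reach (length X) X R)"
  \<comment> \<open>Every arc then has both ends reached, so none crosses the set.\<close>
  have "closed_under ?K r" if "length X \<le> card {r \<in> set X. inside r ?K}"
  proof -
    have "card (set X) \<le> card {r \<in> set X. inside r ?K}" using that card_length le_trans by blast
    then have "{r \<in> set X. inside r ?K} = set X" by (intro card_seteq) auto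
    then show ?thesis using assms by (auto simp: closed_under_def)
  qed
  then show ?thesis using reach_closed_or_many_inside[of X "length X" R] assms by blast
qed

section \<open>Pushing along residual cycles\<close>

text \<open>Inflow of \<open>S\<close> minus its outflow. Tracking all sets at once expresses
  conservation without naming vertices and gives cut values directly.\<close>

definition net :: "cell list \<Rightarrow> val set \<Rightarrow> int" where
  "net X S = (\<Sum>r\<leftarrow>X. int (amt r) * (of_bool (dst r \<in> S) - of_bool (src r \<in> S)))"

lemma adjust_sel [simp]:
  "nm (adjust path r) = nm r" "src (adjust path r) = src r" "dst (adjust path r) = dst r"
  "lo (adjust path r) = lo r" "hi (adjust path r) = hi r"
  by (simp_all add: adjust_def split: option.split)

text \<open>The name is new to the path, so the additional dart changes the amount of
  \<open>r\<close> alone. The condition \<open>b \<or> 0 < amt r\<close> rules out a truncated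
  subtraction.\<close>

lemma net_push_Cons:
  assumes "distinct (map nm X)" "r \<in> set X" "nm r \<notin> fst ` set path" "b \<or> 0 < amt r"
  shows "net (push X ((nm r, b) # path)) S =
    net (push X path) S + (if b then 1 else -1) * (of_bool (dst r \<in> S) - of_bool (src r \<in> S))"
proof -
  define w where "w q = (of_bool (dst q \<in> S) - of_bool (src q \<in> S) :: int)" for q
  have dX: "distinct X" and inj: "inj_on nm (set X)" using assms(1) by (simp_all add: distinct_map)
  have "int (amt (adjust ((nm r, b) # path) q)) * w q =
      int (amt (adjust path q)) * w q + (if q = r then (if b then 1 else -1) * w r else 0)" if "q \<in> set X" for q
  proof (cases "q = r")
    case True
    have "map_of path (nm r) = None" using assms(3) by (simp add: map_of_eq_None_iff)
    then show ?thesis using True assms(4) by (auto simp: adjust_def algebra_simps of_nat_diff)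
  next
    case False
    then have "nm q \<noteq> nm r" using inj that assms(2) by (auto dest: inj_onD)
    then show ?thesis using False by (simp add: adjust_def)
  qed
  then have "(\<Sum>q\<in>set X. int (amt (adjust ((nm r, b) # path) q)) * w q) =
      (\<Sum>q\<in>set X. int (amt (adjust path q)) * w q + (if q = r then (if b then 1 else -1) * w r else 0))"
    by (rule sum.cong[OF refl])
  also have "\<dots> = (\<Sum>q\<in>set X. int (amt (adjust path q)) * w q) + (if b then 1 else -1) * w r"
    using assms(2) by (simp add: sum.distrib)
  finally show ?thesis
    unfolding net_def push_def w_def using dX by (simp add: sum_list_distinct_conv_sum_set o_def)
qed

text \<open>The contributions of the darts telescope along the walk; distinct names let every dart
  take effect.\<close>

lemma net_push_walk:
  assumes "distinct (map nm X)"
  shows "walk X p path q \<Longrightarrow> distinct (map fst path) \<Longrightarrow>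
    net (push X path) S = net X S + of_bool (q \<in> S) - of_bool (p \<in> S)"
proof (induction path arbitrary: q)
  case Nil
  then show ?case by (simp add: push_def net_def adjust_def o_def)
next
  case (Cons d path)
  obtain n b where d: "d = (n, b)" by (cases d)
  obtain r where r: "r \<in> set X" "nm r = n"
    and br: "if b then dst r = q \<and> amt r < hi r \<and> walk X p path (src r)
      else src r = q \<and> lo r < amt r \<and> walk X p path (dst r)"
    using Cons.prems(1) unfolding d by (auto split: if_splits)
  have "net (push X ((nm r, b) # path)) S =
    net (push X path) S + (if b then 1 else -1) * (of_bool (dst r \<in> S) - of_bool (src r \<in> S))"
    using net_push_Cons[OF assms r(1)] Cons.prems(2) br r(2) d by auto
  then show ?case using Cons.IH[of "if b then src r else dst r"] Cons.prems(2) br r(2) d by (auto split: if_splits)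
qed

lemma walk_dart:
  assumes "inj_on nm (set X)" "r \<in> set X"
  shows "walk X p path q \<Longrightarrow> (nm r, b) \<in> set path \<Longrightarrow>
    (if b then amt r < hi r \<and> dst r \<noteq> p else lo r < amt r \<and> src r \<noteq> p)"
proof (induction path arbitrary: q)
  case (Cons d path)
  obtain n b' where d: "d = (n, b')" by (cases d)
  obtain r' where r': "r' \<in> set X" "nm r' = n" "q \<noteq> p"
    and br: "if b' then dst r' = q \<and> amt r' < hi r' \<and> walk X p path (src r')
      else src r' = q \<and> lo r' < amt r' \<and> walk X p path (dst r')"
    using Cons.prems(1) unfolding d by (auto split: if_splits)
  show ?case
  proof (cases "(nm r, b) = d")
    case True
    then have "r' = r" "b' = b" using assms r' d by (auto dest: inj_onD)
    then show ?thesis using br r'(3) by (auto split: if_splits)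
  next
    case False
    then have "(nm r, b) \<in> set path" using Cons.prems(2) by simp
    then show ?thesis using Cons.IH[of "if b' then src r' else dst r'"] br by (cases b') auto
  qed
qed simp

text \<open>No bound gets violated, and no violation gets worse.\<close>

definition closer :: "cell \<Rightarrow> cell \<Rightarrow> bool" where
  "closer r r' \<longleftrightarrow> r' = with_amt r (amt r') \<and> min (lo r) (amt r) \<le> amt r' \<and> amt r' \<le> max (hi r) (amt r)"

text \<open>For \<open>lo r \<le> hi r\<close>, truncated subtraction makes this the distance of the
  amount from the permitted interval.\<close>

definition violation :: "cell \<Rightarrow> nat" where
  "violation r = (lo r - amt r) + (amt r - hi r)"

text \<open>The set \<open>S\<close> contains the vertex at which a repairing path would have to
  start but not the one at which it would have to end.\<close>

definition stuck :: "cell list \<Rightarrow> bool" where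
  "stuck X \<longleftrightarrow> (\<forall>r \<in> set X. amt r < lo r \<or> hi r < amt r \<longrightarrow>
     (\<exists>S. (if amt r < lo r then dst r \<in> S \<and> src r \<notin> S else src r \<in> S \<and> dst r \<notin> S) \<and>
        (\<forall>q \<in> set X. closed_under S q)))"

definition consistent :: "cell list \<Rightarrow> bool" where
  "consistent X \<longleftrightarrow> distinct (map nm X) \<and> (\<forall>r \<in> set X. lo r \<le> hi r)"

lemma find_path_Some:
  assumes "distinct (map nm X)" "find_path p q X = Some path"
  shows "walk X p path q" "distinct (map fst path)"
proof -
  have "traced X p (reach (length X) X [(p, [])])" using assms(1) by (intro traced_reach) (simp add: distinct_map)
  moreover have "(q, path) \<in> set (reach (length X) X [(p, [])])"
    using assms(2) map_of_SomeD unfolding find_path_def by fast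
  ultimately show "walk X p path q" "distinct (map fst path)" by (auto simp: traced_def)
qed

lemma find_path_None:
  assumes "distinct (map nm X)" "find_path p q X = None"
  shows "\<exists>S. p \<in> S \<and> q \<notin> S \<and> (\<forall>r \<in> set X. closed_under S r)"
proof -
  have "traced X p (reach (length X) X [(p, [])])" using assms(1) by (intro traced_reach) (simp add: distinct_map)
  moreover have "q \<notin> keys (reach (length X) X [(p, [])])"
    using assms(2) by (simp add: find_path_def map_of_eq_None_iff)
  ultimately show ?thesis
    by (intro exI[of _ "keys (reach (length X) X [(p, [])])"]) (auto simp: traced_def reach_closed)
qed

lemma closer_adjust:
  assumes "lo r \<le> hi r"
    and "\<And>b. map_of path (nm r) = Some b \<Longrightarrow> if b then amt r < hi r else lo r < amt r"
  shows "closer r (adjust path r)"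
proof (cases "map_of path (nm r)")
  case None
  then show ?thesis by (cases r) (simp add: closer_def adjust_def with_amt_def)
next
  case (Some b)
  then show ?thesis using assms(1) assms(2)[OF Some] by (auto simp: closer_def adjust_def split: if_splits)
qed

lemma closer_sel:
  assumes "closer r r'"
  shows "nm r' = nm r" "src r' = src r" "dst r' = dst r" "lo r' = lo r" "hi r' = hi r"
  using assms unfolding closer_def by (metis with_amt_sel)+

lemma closer_violation: "closer r r' \<Longrightarrow> violation r' \<le> violation r"
  using closer_sel[of r r'] by (auto simp: closer_def violation_def)

text \<open>The path joins the two ends of the violated arc, so path and arc cancel in every
  \<open>net\<close>. Residual darts never increase a violation, while the violated arc moves one
  unit towards its interval.\<close>

lemma push_repair:
  assumes X: "consistent X" and r: "r \<in> set X" and path: "repair r X = Some path"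
  shows "list_all2 closer X (push X path)" "net (push X path) S = net X S"
    "(\<Sum>q\<leftarrow>push X path. violation q) < (\<Sum>q\<leftarrow>X. violation q)"
proof -
  have dX: "distinct (map nm X)" "inj_on nm (set X)" and lohi: "\<And>q. q \<in> set X \<Longrightarrow> lo q \<le> hi q"
    using X by (auto simp: consistent_def distinct_map)
  obtain b path' p q where path': "path = (nm r, b) # path'"
    and fp: "find_path p q X = Some path'"
    and b: "if b then amt r < lo r \<and> p = dst r \<and> q = src r else hi r < amt r \<and> p = src r \<and> q = dst r"
    using path unfolding repair_def by (auto split: if_splits)
  note w = find_path_Some[OF dX(1) fp]
  \<comment> \<open>In the repairing direction the arc ends at the origin \<open>p\<close>, which a
    walk never revisits; in the opposite direction it is not residual.\<close>
  have notin: "nm r \<notin> fst ` set path'"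
  proof
    assume "nm r \<in> fst ` set path'"
    then obtain b' where "(nm r, b') \<in> set path'" by auto
    from walk_dart[OF dX(2) r w(1) this] b lohi[OF r] show False by (auto split: if_splits)
  qed
  show "net (push X path) S = net X S"
    using net_push_Cons[OF dX(1) r notin, of b S] net_push_walk[OF dX(1) w, of S] b path'
    by (auto split: if_splits)
  have ok: "if b' then amt q < hi q else lo q < amt q" if "q \<in> set X" "map_of path (nm q) = Some b'" for q b'
  proof (cases "q = r")
    case True
    then show ?thesis using b lohi[OF r] that(2) path' by (auto split: if_splits)
  next
    case False
    then have "nm q \<noteq> nm r" using dX(2) that(1) r by (auto dest: inj_onD)
    then have "(nm q, b') \<in> set path'" using that(2) path' by (auto dest: map_of_SomeD)
    from walk_dart[OF dX(2) that(1) w(1) this] show ?thesis by (auto split: if_splits)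
  qed
  then have cl: "\<And>q. q \<in> set X \<Longrightarrow> closer q (adjust path q)" using lohi by (intro closer_adjust) auto
  then show "list_all2 closer X (push X path)"
    unfolding push_def list_all2_map2 by (rule list.rel_refl_strong)
  have "(\<Sum>q\<in>set X. violation (adjust path q)) < (\<Sum>q\<in>set X. violation q)"
  proof (rule sum_strict_mono_ex1)
    show "\<forall>q\<in>set X. violation (adjust path q) \<le> violation q" using cl closer_violation by blast
    show "\<exists>q\<in>set X. violation (adjust path q) < violation q"
      using r b lohi[OF r] path' by (intro bexI[of _ r]) (auto simp: violation_def adjust_def split: if_splits)
  qed simp
  then show "(\<Sum>q\<leftarrow>push X path. violation q) < (\<Sum>q\<leftarrow>X. violation q)"
    using dX(1) by (simp add: push_def o_def sum_list_distinct_conv_sum_set distinct_map)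
qed

lemma repair_None:
  assumes X: "consistent X" and r: "r \<in> set X" "repair r X = None" and "amt r < lo r \<or> hi r < amt r"
  shows "\<exists>S. (if amt r < lo r then dst r \<in> S \<and> src r \<notin> S else src r \<in> S \<and> dst r \<notin> S) \<and>
        (\<forall>q \<in> set X. closed_under S q)"
proof -
  have dX: "distinct (map nm X)" using X by (simp add: consistent_def)
  show ?thesis
  proof (cases "amt r < lo r")
    case True
    then show ?thesis using find_path_None[OF dX, of "dst r" "src r"] r(2) by (simp add: repair_def)
  next
    case False
    then show ?thesis using find_path_None[OF dX, of "src r" "dst r"] r(2) assms(4) by (simp add: repair_def)
  qed
qed

lemma improve_cases:
  "set Y \<subseteq> set X \<Longrightarrow> (\<forall>r \<in> set Y. repair r X = None) \<and> improve Y X = X \<or>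
    (\<exists>r \<in> set X. \<exists>path. repair r X = Some path \<and> improve Y X = push X path)"
  by (induction Y) (auto split: option.split)

lemma closer_refl: "closer r r"
  by (cases r) (simp add: closer_def with_amt_def)

lemma closer_trans: "closer r r' \<Longrightarrow> closer r' r'' \<Longrightarrow> closer r r''"
  unfolding closer_def with_amt_def by (cases r; cases r'; cases r'') auto

lemma consistent_closer:
  assumes "list_all2 closer X X'" "consistent X"
  shows "consistent X'"
proof -
  have "map nm X' = map nm X" using assms(1) by induction (auto dest: closer_sel)
  moreover have "lo r' \<le> hi r'" if "r' \<in> set X'" for r'
  proof -
    obtain i where i: "i < length X'" "X' ! i = r'" using \<open>r' \<in> set X'\<close> unfolding in_set_conv_nth by blast
    then have "X ! i \<in> set X" using list_all2_lengthD[OF assms(1)] by simp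
    moreover have "closer (X ! i) r'" using list_all2_nthD2[OF assms(1) i(1)] i(2) by simp
    ultimately show ?thesis using assms(2) closer_sel[of "X ! i" r'] by (simp add: consistent_def)
  qed
  ultimately show ?thesis using assms(2) by (simp add: consistent_def)
qed

text \<open>Either an iteration lowers the total violation, or no arc can be repaired and the state
  is a fixed point. In the second case the remaining fuel changes nothing, and the failed searches,
  all made in this same state, supply the certificates.\<close>

lemma repeat_spec:
  assumes "consistent X" "(\<Sum>q\<leftarrow>X. violation q) \<le> n"
  shows "list_all2 closer X (repeat n X) \<and> (\<forall>S. net (repeat n X) S = net X S) \<and> stuck (repeat n X)"
  using assms
proof (induction n arbitrary: X)
  case 0
  then have "\<forall>r \<in> set X. violation r = 0" by simp
  then have "stuck X" by (auto simp: stuck_def violation_def)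
  then show ?case by (simp add: repeat_def list.rel_refl closer_refl)
next
  case (Suc n)
  have step: "repeat (Suc n) X = repeat n (improve X X)"
    by (simp add: repeat_def funpow_Suc_right del: funpow.simps)
  consider "\<forall>r \<in> set X. repair r X = None" "improve X X = X" |
    r path where "r \<in> set X" "repair r X = Some path" "improve X X = push X path"
    using improve_cases[of X X] by auto
  then show ?case
  proof cases
    case 1
    have "repeat m X = X" for m by (induction m) (simp_all add: repeat_def 1(2))
    moreover have "stuck X" unfolding stuck_def using repair_None[OF Suc.prems(1)] 1(1) by blast
    ultimately show ?thesis by (simp add: list.rel_refl closer_refl)
  next
    case 2
    note p = push_repair[OF Suc.prems(1) 2(1,2), folded 2(3)]
    have "list_all2 closer (improve X X) (repeat n (improve X X)) \<and>
      (\<forall>S. net (repeat n (improve X X)) S = net (improve X X) S) \<and> stuck (repeat n (improve X X))"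
      using Suc.prems p(3) by (intro Suc.IH consistent_closer[OF p(1)]) auto
    then show ?thesis unfolding step using p(2) list_all2_trans[OF closer_trans p(1)] by auto
  qed
qed

lemma solve_spec:
  assumes "consistent X" "(\<Sum>q\<leftarrow>X. violation q) \<le> 2 * length X"
  shows "list_all2 closer X (solve X)" "net (solve X) S = net X S" "stuck (solve X)"
proof -
  have "solve X = repeat (2 * length X) X"
    unfolding solve_def repeat_def mult_2 funpow_add by simp
  then show "list_all2 closer X (solve X)" "net (solve X) S = net X S" "stuck (solve X)"
    using repeat_spec[OF assms] by auto
qed

section \<open>Running time of the search\<close>

abbreviation enc_cells :: "cell list \<Rightarrow> val" where
  "enc_cells \<equiv> enc_list enc_cell"

definition enc_assoc :: "('b \<Rightarrow> val) \<Rightarrow> (val \<times> 'b) list \<Rightarrow> val" where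
  "enc_assoc e R = enc_list (\<lambda>(k, b). Node k (e b)) R"

abbreviation enc_path :: "dart list \<Rightarrow> val" where
  "enc_path \<equiv> enc_assoc val_of_bool"

abbreviation enc_table :: "table \<Rightarrow> val" where
  "enc_table \<equiv> enc_assoc enc_path"

lemma enc_assoc_simps [simp]:
  "enc_assoc e [] = Leaf"
  "enc_assoc e (x # R) = Node (Node (fst x) (e (snd x))) (enc_assoc e R)"
  by (simp_all add: enc_assoc_def case_prod_beta)

lemma enc_list_map: "enc_list e (map F xs) = enc_list (\<lambda>x. e (F x)) xs"
  by (induction xs) auto

lemma enc_list_cong: "(\<And>x. x \<in> set xs \<Longrightarrow> e x = e' x) \<Longrightarrow> enc_list e xs = enc_list e' xs"
  by (induction xs) auto

lemma enc_list_eq_Leaf [simp]: "enc_list e xs = Leaf \<longleftrightarrow> xs = []"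
  by (cases xs) auto

lemma enc_cell_Cell [simp]:
  "enc_cell (Cell n u v x l h) = Node n (Node (Node u v) (Node (unary x) (Node (unary l) (unary h))))"
  by (simp add: enc_cell_def)

lemma sel_enc_cell [simp]:
  "left_of (enc_cell r) = nm r"
  "left_of (right_of (enc_cell r)) = Node (src r) (dst r)"
  "left_of (right_of (right_of (enc_cell r))) = unary (amt r)"
  "left_of (right_of (right_of (right_of (enc_cell r)))) = unary (lo r)"
  "right_of (right_of (right_of (right_of (enc_cell r)))) = unary (hi r)"
  by (simp_all add: enc_cell_def)

lemma look_computes:
  assumes "val_size v \<le> N"
  shows "\<forall>x \<in> set R. val_size (fst x) \<le> N \<Longrightarrow> computes LOOK [v, enc_assoc e R]
    (case map_of R v of None \<Rightarrow> Leaf | Some b \<Rightarrow> Node v (e b)) ((length R + 1) * (2 * N + 20))"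
proof (induction R)
  case Nil
  show ?case by (rule computesI) (simp_all add: prog_def wp_simps)
next
  case (Cons x R)
  have IH: "computes LOOK [v, enc_assoc e R]
    (case map_of R v of None \<Rightarrow> Leaf | Some b \<Rightarrow> Node v (e b)) ((length R + 1) * (2 * N + 20))"
    using Cons by simp
  show ?case
    using cost_computes[OF IH] assms Cons.prems
    by (intro computesI) (auto simp: prog_def wp_simps wp_call_computes[OF IH])
qed

text \<open>A single \<open>m\<close> bounds the number of entries and the lengths of the paths,
  because a new entry extends a stored path by one dart.\<close>

definition small_table :: "nat \<Rightarrow> nat \<Rightarrow> table \<Rightarrow> bool" where
  "small_table N m R \<longleftrightarrow> length R \<le> m \<and> (\<forall>(k, path) \<in> set R. val_size k \<le> N \<and> length path \<le> m \<and>
     (\<forall>d \<in> set path. val_size (fst d) \<le> N))"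

text \<open>The amount is left unbounded: comparisons stop at the shorter operand, and every other
  access to it takes constant time. Hence pushes trivially preserve smallness.\<close>

definition small_cell :: "nat \<Rightarrow> cell \<Rightarrow> bool" where
  "small_cell N r \<longleftrightarrow> val_size (nm r) \<le> N \<and> val_size (src r) \<le> N \<and> val_size (dst r) \<le> N \<and>
     lo r \<le> N \<and> hi r \<le> N"

definition small :: "nat \<Rightarrow> cell list \<Rightarrow> bool" where
  "small N X \<longleftrightarrow> length X \<le> N \<and> (\<forall>r \<in> set X. small_cell N r)"

lemma small_table_mono: "small_table N m R \<Longrightarrow> m \<le> m' \<Longrightarrow> small_table N m' R"
  by (auto simp: small_table_def)

lemma small_table_look:
  assumes "small_table N m R" "val_size v \<le> N"
  shows "computes LOOK [v, enc_table R]
    (case map_of R v of None \<Rightarrow> Leaf | Some path \<Rightarrow> Node v (enc_path path)) ((m + 1) * (2 * N + 20))"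
proof (rule computes_mono[OF look_computes[OF assms(2)]])
  show "\<forall>x \<in> set R. val_size (fst x) \<le> N" using assms(1) by (auto simp: small_table_def)
  show "(length R + 1) * (2 * N + 20) \<le> (m + 1) * (2 * N + 20)"
    using assms(1) by (intro mult_le_mono1) (simp add: small_table_def)
qed

lemma extend_computes:
  assumes "small_table N m R" "val_size p \<le> N" "val_size q \<le> N"
  shows "computes EXTEND [p, q, Node n (val_of_bool b), enc_table R] (enc_table (extend p q (n, b) R))
    (2 * ((m + 1) * (2 * N + 20)) + 40)"
  using cost_computes[OF small_table_look[OF assms(1,2)]] cost_computes[OF small_table_look[OF assms(1,3)]]
  by (intro computesI) (auto simp: prog_def wp_simps extend_def split: option.splits
      simp: wp_call_computes[OF small_table_look[OF assms(1,2)]] wp_call_computes[OF small_table_look[OF assms(1,3)]])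

lemma small_table_extend:
  assumes "small_table N m R" "val_size q \<le> N" "val_size n \<le> N"
  shows "small_table N (Suc m) (extend p q (n, b) R)"
proof (cases "map_of R p")
  case None
  then show ?thesis using small_table_mono[OF assms(1), of "Suc m"] by (simp add: extend_def)
next
  case (Some path)
  have "(p, path) \<in> set R" using Some by (rule map_of_SomeD)
  then show ?thesis using assms small_table_mono[OF assms(1), of "Suc m"] Some
    by (auto simp: extend_def small_table_def)
qed

definition visit_bound :: "nat \<Rightarrow> nat \<Rightarrow> nat" where
  "visit_bound N m = 4 * ((m + 2) * (2 * N + 20)) + 40 * (N + 1) + 300"

lemma visit_bound_mono: "m \<le> m' \<Longrightarrow> visit_bound N m \<le> visit_bound N m'"
  unfolding visit_bound_def by (intro add_le_mono mult_le_mono) auto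

text \<open>Each of the two directions adds at most one entry. The 50 units held back pay for the
  steps of \<open>PASS\<close> around the call.\<close>

lemma visit_computes:
  assumes "small_table N m R" "small_cell N r"
  shows "computes VISIT [enc_cell r, enc_table R] (enc_table (visit r R)) (visit_bound N m - 50)"
    and "small_table N (m + 2) (visit r R)"
proof -
  note r = assms(2)[unfolded small_cell_def]
  define R' where "R' = (if amt r < hi r then extend (src r) (dst r) (nm r, True) R else R)"
  have R': "small_table N (Suc m) R'"
    unfolding R'_def using small_table_extend[OF assms(1)] small_table_mono[OF assms(1), of "Suc m"] r by simp
  then show "small_table N (m + 2) (visit r R)"
    unfolding visit_def Let_def R'_def[symmetric]
    using small_table_extend[OF R'] small_table_mono[OF R', of "Suc (Suc m)"] r by simp
  have e1: "computes EXTEND [src r, dst r, Node (nm r) (Node Leaf Leaf), enc_table R]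
      (enc_table (extend (src r) (dst r) (nm r, True) R)) (2 * ((m + 1) * (2 * N + 20)) + 40)"
    using extend_computes[OF assms(1), of "src r" "dst r" "nm r" True] r by (simp add: val_of_bool_def)
  have e2: "computes EXTEND [dst r, src r, Node (nm r) Leaf, enc_table R']
      (enc_table (extend (dst r) (src r) (nm r, False) R')) (2 * ((Suc m + 1) * (2 * N + 20)) + 40)"
    using extend_computes[OF R', of "dst r" "src r" "nm r" False] r by (simp add: val_of_bool_def)
  note l1 = less_computes[of "amt r" "hi r"] and l2 = less_computes[of "lo r" "amt r"]
  have c: "cost LESS [unary (amt r), unary (hi r)] \<le> 20 * (N + 1)"
    "cost LESS [unary (lo r), unary (amt r)] \<le> 20 * (N + 1)"
    using cost_computes[OF l1] cost_computes[OF l2] r by auto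
  show "computes VISIT [enc_cell r, enc_table R] (enc_table (visit r R)) (visit_bound N m - 50)"
  proof (cases "amt r < hi r")
    case True
    then have "R' = extend (src r) (dst r) (nm r, True) R" by (simp add: R'_def)
    note e2 = e2[unfolded this]
    show ?thesis
      using c cost_computes[OF e1] cost_computes[OF e2] True
      by (intro computesI) (auto simp: prog_def wp_simps visit_def Let_def wp_call_computes[OF l1]
          wp_call_computes[OF l2] wp_call_computes[OF e1] wp_call_computes[OF e2] visit_bound_def)
  next
    case False
    then have "R' = R" by (simp add: R'_def)
    note e2 = e2[unfolded this]
    show ?thesis
      using c cost_computes[OF e1] cost_computes[OF e2] False
      by (intro computesI) (auto simp: prog_def wp_simps visit_def Let_def wp_call_computes[OF l1]
          wp_call_computes[OF l2] wp_call_computes[OF e1] wp_call_computes[OF e2] visit_bound_def)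
  qed
qed

lemma small_table_pass:
  "small_table N m R \<Longrightarrow> \<forall>r \<in> set X. small_cell N r \<Longrightarrow> small_table N (m + 2 * length X) (pass X R)"
proof (induction X arbitrary: m R)
  case (Cons r X)
  then show ?case using Cons.IH[OF visit_computes(2)[of N m R r]] by (simp add: pass_def)
qed (simp add: pass_def)

lemma pass_computes:
  "small_table N m R \<Longrightarrow> \<forall>r \<in> set X. small_cell N r \<Longrightarrow> m + 2 * length X \<le> M \<Longrightarrow>
   computes PASS [enc_cells X, enc_table R] (enc_table (pass X R)) ((length X + 1) * visit_bound N M)"
proof (induction X arbitrary: m R)
  case Nil
  show ?case by (rule computesI) (simp_all add: prog_def wp_simps pass_def visit_bound_def)
next
  case (Cons r X)
  have v: "computes VISIT [enc_cell r, enc_table R] (enc_table (visit r R)) (visit_bound N M - 50)"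
    using visit_computes(1)[of N m R r] visit_bound_mono[of m M N] Cons.prems
    by (auto elim!: computes_mono)
  have IH: "computes PASS [enc_cells X, enc_table (visit r R)] (enc_table (pass X (visit r R)))
      ((length X + 1) * visit_bound N M)"
    using Cons.prems by (intro Cons.IH[OF visit_computes(2)[of N m R r]]) auto
  have "visit_bound N M \<ge> 300" by (simp add: visit_bound_def)
  then show ?case
    using cost_computes[OF v] cost_computes[OF IH]
    by (intro computesI) (auto simp: prog_def wp_simps wp_call_computes[OF v] wp_call_computes[OF IH] pass_def)
qed

lemma small_table_reach:
  assumes "small N X" "small_table N m R"
  shows "small_table N (m + 2 * N * n) (reach n X R)"
proof (induction n)
  case 0
  then show ?case using assms(2) by (simp add: reach_def)
next
  case (Suc n)
  have "small_table N (m + 2 * N * n + 2 * length X) (reach (Suc n) X R)"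
    using small_table_pass[OF Suc, of X] assms(1) by (simp add: reach_def small_def)
  then show ?case by (rule small_table_mono) (use assms(1) in \<open>simp add: small_def algebra_simps\<close>)
qed

lemma reach_computes:
  assumes "small N X"
  shows "small_table N m R \<Longrightarrow> m + 2 * N * length ys \<le> M \<Longrightarrow>
   computes REACH [enc_list g ys, enc_cells X, enc_table R] (enc_table (reach (length ys) X R))
     ((length ys + 1) * ((N + 1) * visit_bound N M + 20))"
proof (induction ys arbitrary: m R)
  case Nil
  show ?case by (rule computesI) (simp_all add: prog_def wp_simps reach_def)
next
  case (Cons y ys)
  have len: "length X \<le> N" and X: "\<forall>r \<in> set X. small_cell N r" using assms by (auto simp: small_def)
  have "m + 2 * length X \<le> M" using Cons.prems(2) len by (auto simp: algebra_simps)
  then have v: "computes PASS [enc_cells X, enc_table R] (enc_table (pass X R)) ((N + 1) * visit_bound N M)"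
    by (rule computes_mono[OF pass_computes[OF Cons.prems(1) X]]) (use len in \<open>simp add: mult_le_mono1\<close>)
  have "m + 2 * N + 2 * N * length ys \<le> M" using Cons.prems(2) by (simp add: algebra_simps)
  moreover have "small_table N (m + 2 * N) (pass X R)"
    by (rule small_table_mono[OF small_table_pass[OF Cons.prems(1) X]]) (use len in simp)
  ultimately have IH: "computes REACH [enc_list g ys, enc_cells X, enc_table (pass X R)]
     (enc_table (reach (length ys) X (pass X R))) ((length ys + 1) * ((N + 1) * visit_bound N M + 20))"
    by (intro Cons.IH)
  have "reach (length ys) X (pass X R) = reach (length (y # ys)) X R"
    by (simp add: reach_def funpow_swap1)
  then show ?case
    using cost_computes[OF v] cost_computes[OF IH]
    by (intro computesI) (auto simp: prog_def wp_simps wp_call_computes[OF v] wp_call_computes[OF IH])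
qed

text \<open>The initial entry, and at most two new ones for each of at most \<open>N\<close> cells
  in each of at most \<open>N\<close> passes.\<close>

definition table_bound :: "nat \<Rightarrow> nat" where
  "table_bound N = 1 + 2 * N * N"

definition find_bound :: "nat \<Rightarrow> nat" where
  "find_bound N = (N + 1) * ((N + 1) * visit_bound N (table_bound N) + 20) +
     (table_bound N + 1) * (2 * N + 20) + 40"

lemma find_path_computes:
  assumes "small N X" "val_size p \<le> N" "val_size q \<le> N"
  shows "computes FIND [p, q, enc_cells X]
    (case find_path p q X of None \<Rightarrow> Leaf | Some path \<Rightarrow> Node q (enc_path path)) (find_bound N)"
    and "find_path p q X = Some path \<Longrightarrow> length path \<le> table_bound N \<and> (\<forall>d \<in> set path. val_size (fst d) \<le> N)"
proof -
  let ?R = "reach (length X) X [(p, [])]" and ?V = "(N + 1) * visit_bound N (table_bound N) + 20"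
  have len: "length X \<le> N" using assms(1) by (simp add: small_def)
  have init: "small_table N 1 [(p, [])]" using assms(2) by (simp add: small_table_def)
  have NN: "1 + 2 * N * length X \<le> table_bound N" using len by (simp add: table_bound_def)
  have R: "small_table N (table_bound N) ?R"
    by (rule small_table_mono[OF small_table_reach[OF assms(1) init] NN])
  have r0: "computes REACH [enc_cells X, enc_cells X, enc_table [(p, [])]] (enc_table ?R)
     ((length X + 1) * ?V)"
    by (rule reach_computes[OF assms(1) init NN])
  have "(length X + 1) * ?V \<le> (N + 1) * ?V" using len by (intro mult_le_mono1) simp
  then have r: "computes REACH [enc_cells X, enc_cells X, Node (Node p Leaf) Leaf] (enc_table ?R) ((N + 1) * ?V)"
    using computes_mono[OF r0] by simp
  note l = small_table_look[OF R assms(3)]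
  show "computes FIND [p, q, enc_cells X]
    (case find_path p q X of None \<Rightarrow> Leaf | Some path \<Rightarrow> Node q (enc_path path)) (find_bound N)"
    unfolding find_path_def find_bound_def using cost_computes[OF r] cost_computes[OF l]
    by (intro computesI) (auto simp: prog_def wp_simps wp_call_computes[OF r] wp_call_computes[OF l])
  assume "find_path p q X = Some path"
  then have "(q, path) \<in> set ?R" unfolding find_path_def by (rule map_of_SomeD)
  then show "length path \<le> table_bound N \<and> (\<forall>d \<in> set path. val_size (fst d) \<le> N)"
    using R by (auto simp: small_table_def)
qed

definition push_bound :: "nat \<Rightarrow> nat" where
  "push_bound N = (table_bound N + 2) * (2 * N + 20) + 100"

lemma push_computes:
  "small N X \<Longrightarrow> length path \<le> table_bound N + 1 \<Longrightarrow> \<forall>d \<in> set path. val_size (fst d) \<le> N \<Longrightarrow>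
   computes PUSH [enc_cells X, enc_path path] (enc_cells (push X path)) ((length X + 1) * push_bound N)"
proof (induction X)
  case Nil
  show ?case by (rule computesI) (simp_all add: prog_def wp_simps push_def push_bound_def)
next
  case (Cons r X)
  have IH: "computes PUSH [enc_cells X, enc_path path] (enc_cells (push X path)) ((length X + 1) * push_bound N)"
    using Cons by (simp add: small_def)
  have "val_size (nm r) \<le> N" using Cons.prems(1) by (simp add: small_def small_cell_def)
  note l0 = look_computes[OF this, of path val_of_bool]
  have l: "computes LOOK [nm r, enc_path path]
     (case map_of path (nm r) of None \<Rightarrow> Leaf | Some b \<Rightarrow> Node (nm r) (val_of_bool b))
     ((table_bound N + 2) * (2 * N + 20))"
  proof (rule computes_mono[OF l0])
    show "(length path + 1) * (2 * N + 20) \<le> (table_bound N + 2) * (2 * N + 20)"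
      using Cons.prems(2) by (intro mult_le_mono1) simp
  qed (use Cons.prems in simp)
  show ?case
    using cost_computes[OF IH] cost_computes[OF l]
    by (intro computesI) (auto simp: prog_def wp_simps wp_call_computes[OF IH] wp_call_computes[OF l]
        push_def adjust_def enc_cell_def[of r] with_amt_def push_bound_def split: option.splits)
qed

lemma small_push: "small N X \<Longrightarrow> small N (push X path)"
  by (simp add: small_def push_def small_cell_def)

lemma small_improve: "small N X \<Longrightarrow> small N (improve Y X)"
  by (induction Y) (auto split: option.split intro: small_push)

lemma small_repeat: "small N X \<Longrightarrow> small N (repeat n X)"
  by (induction n) (simp_all add: repeat_def small_improve)

lemma small_solve: "small N X \<Longrightarrow> small N (solve X)"
  by (simp add: solve_def small_repeat)

text \<open>There may be a search for every candidate but there is only one push, since the first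
  success ends the loop.\<close>

definition improve_bound :: "nat \<Rightarrow> nat" where
  "improve_bound N = (N + 1) * (find_bound N + 40 * (N + 1) + 100) + (N + 1) * push_bound N"

lemma improve_computes:
  assumes X: "small N X"
  shows "\<forall>r \<in> set Y. small_cell N r \<Longrightarrow>
   computes IMPROVE [enc_cells Y, enc_cells X] (enc_cells (improve Y X))
     ((length Y + 1) * (find_bound N + 40 * (N + 1) + 100) + (N + 1) * push_bound N)"
proof (induction Y)
  case Nil
  show ?case by (rule computesI) (simp_all add: prog_def wp_simps)
next
  case (Cons r Y)
  have len: "length X \<le> N" using X by (simp add: small_def)
  have IH: "computes IMPROVE [enc_cells Y, enc_cells X] (enc_cells (improve Y X))
     ((length Y + 1) * (find_bound N + 40 * (N + 1) + 100) + (N + 1) * push_bound N)"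
    using Cons by simp
  have r: "val_size (nm r) \<le> N" "val_size (src r) \<le> N" "val_size (dst r) \<le> N" "lo r \<le> N" "hi r \<le> N"
    using Cons.prems by (auto simp: small_cell_def)
  note l1 = less_computes[of "amt r" "lo r"] and l2 = less_computes[of "hi r" "amt r"]
  have c: "cost LESS [unary (amt r), unary (lo r)] \<le> 20 * (N + 1)"
    "cost LESS [unary (hi r), unary (amt r)] \<le> 20 * (N + 1)"
    using cost_computes[OF l1] cost_computes[OF l2] r by auto
  note f1 = find_path_computes[OF X r(3,2)] and f2 = find_path_computes[OF X r(2,3)]
  have p: "computes PUSH [enc_cells X, Node (Node (nm r) (val_of_bool b)) (enc_path path)]
      (enc_cells (push X ((nm r, b) # path))) ((N + 1) * push_bound N)"
    if "length path \<le> table_bound N \<and> (\<forall>d \<in> set path. val_size (fst d) \<le> N)" for b path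
  proof -
    have "computes PUSH [enc_cells X, enc_path ((nm r, b) # path)]
      (enc_cells (push X ((nm r, b) # path))) ((length X + 1) * push_bound N)"
      using that r by (intro push_computes[OF X]) auto
    then show ?thesis using len by (auto elim!: computes_mono)
  qed
  consider (low) "amt r < lo r" | (high) "\<not> amt r < lo r" "hi r < amt r"
    | (fine) "\<not> amt r < lo r" "\<not> hi r < amt r" by blast
  then show ?case
  proof cases
    case low
    show ?thesis
    proof (cases "find_path (dst r) (src r) X")
      case None
      show ?thesis using c cost_computes[OF f1(1)] cost_computes[OF IH] low None
        by (intro computesI) (auto simp: prog_def wp_simps wp_call_computes[OF l1]
           wp_call_computes[OF f1(1)] wp_call_computes[OF IH] repair_def)
    next
      case (Some path)
      have p: "computes PUSH [enc_cells X, Node (Node (nm r) (Node Leaf Leaf)) (enc_path path)]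
         (enc_cells (push X ((nm r, True) # path))) ((N + 1) * push_bound N)"
        using p[OF f1(2)[OF Some], of True] by (simp add: val_of_bool_def)
      show ?thesis using c cost_computes[OF f1(1)] cost_computes[OF p] low Some
        by (intro computesI) (auto simp: prog_def wp_simps wp_call_computes[OF l1]
           wp_call_computes[OF f1(1)] wp_call_computes[OF p] repair_def)
    qed
  next
    case high
    show ?thesis
    proof (cases "find_path (src r) (dst r) X")
      case None
      show ?thesis using c cost_computes[OF f2(1)] cost_computes[OF IH] high None
        by (intro computesI) (auto simp: prog_def wp_simps wp_call_computes[OF l1] wp_call_computes[OF l2]
           wp_call_computes[OF f2(1)] wp_call_computes[OF IH] repair_def)
    next
      case (Some path)
      have p: "computes PUSH [enc_cells X, Node (Node (nm r) Leaf) (enc_path path)]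
         (enc_cells (push X ((nm r, False) # path))) ((N + 1) * push_bound N)"
        using p[OF f2(2)[OF Some], of False] by (simp add: val_of_bool_def)
      show ?thesis using c cost_computes[OF f2(1)] cost_computes[OF p] high Some
        by (intro computesI) (auto simp: prog_def wp_simps wp_call_computes[OF l1] wp_call_computes[OF l2]
           wp_call_computes[OF f2(1)] wp_call_computes[OF p] repair_def)
    qed
  next
    case fine
    show ?thesis using c cost_computes[OF IH] fine
      by (intro computesI) (auto simp: prog_def wp_simps wp_call_computes[OF l1] wp_call_computes[OF l2]
         wp_call_computes[OF IH] repair_def)
  qed
qed

lemma improve_self_computes:
  assumes "small N X"
  shows "computes IMPROVE [enc_cells X, enc_cells X] (enc_cells (improve X X)) (improve_bound N)"
  unfolding improve_bound_def
  by (rule computes_mono[OF improve_computes[OF assms]]) (use assms in \<open>auto simp: small_def intro!: mult_le_mono1\<close>)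

lemma repeat_computes:
  "small N X \<Longrightarrow> computes REPEAT [enc_list g ys, enc_cells X] (enc_cells (repeat (length ys) X))
     ((length ys + 1) * (improve_bound N + 20))"
proof (induction ys arbitrary: X)
  case Nil
  show ?case by (rule computesI) (simp_all add: prog_def wp_simps repeat_def)
next
  case (Cons y ys)
  note i = improve_self_computes[OF Cons.prems]
  note IH = Cons.IH[OF small_improve[OF Cons.prems, of X]]
  have eq: "repeat (length ys) (improve X X) = repeat (length (y # ys)) X"
    by (simp add: repeat_def funpow_Suc_right del: funpow.simps)
  show ?case
    unfolding eq[symmetric] using cost_computes[OF i] cost_computes[OF IH]
    by (intro computesI) (auto simp: prog_def wp_simps wp_call_computes[OF i] wp_call_computes[OF IH])
qed

definition solve_bound :: "nat \<Rightarrow> nat" where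
  "solve_bound N = 2 * ((N + 1) * (improve_bound N + 20)) + 20"

lemma solve_computes:
  assumes X: "small N X"
  shows "computes SOLVE [enc_cells X] (enc_cells (solve X)) (solve_bound N)"
proof -
  have le: "(length X + 1) * (improve_bound N + 20) \<le> (N + 1) * (improve_bound N + 20)"
    using X by (intro mult_le_mono1) (simp add: small_def)
  note r1 = computes_mono[OF repeat_computes[OF X, of enc_cell X] le]
  note r2 = computes_mono[OF repeat_computes[OF small_repeat[OF X], of enc_cell X "length X"] le]
  show ?thesis
    unfolding solve_def solve_bound_def using cost_computes[OF r1] cost_computes[OF r2]
    by (intro computesI) (auto simp: prog_def wp_simps wp_call_computes[OF r1] wp_call_computes[OF r2])
qed

section \<open>The program as a whole\<close>

definition init :: "(val \<times> val \<times> val) list \<Rightarrow> cell list" where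
  "init A = map (\<lambda>(a, u, v). Cell a u v 0 0 1) A"

definition scale :: "nat \<Rightarrow> nat \<Rightarrow> cell list \<Rightarrow> cell list" where
  "scale k u X = map (\<lambda>r. Cell (nm r) (src r) (dst r) (if amt r = 0 then 0 else k) 0 u) X"

text \<open>For loads up to \<open>k\<close> the new bounds are the load divided by
  \<open>k\<close>, rounded down and rounded up.\<close>

definition bound :: "nat \<Rightarrow> cell list \<Rightarrow> cell list" where
  "bound k X = map (\<lambda>r. Cell (nm r) (src r) (dst r) 0 (if amt r < k then 0 else 1) (if amt r = 0 then 0 else 1)) X"

definition subtract :: "cell list \<Rightarrow> cell list \<Rightarrow> cell list" where
  "subtract X F = map2 (\<lambda>r q. with_amt r (if amt q = 0 then amt r else amt r - 1)) X F"

text \<open>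
  The arc that closes a flow to a circulation. Its name is a bit string with a leading zero,
  hence differs from the names of all arcs of the input.
\<close>

definition return_cell :: "val \<Rightarrow> val \<Rightarrow> nat \<Rightarrow> cell" where
  "return_cell s t b = Cell (Node Leaf Leaf) t s 0 b b"

text \<open>Equal lower and upper bounds on the return arc prescribe the value \<open>m\<close>;
  \<open>tl\<close> then drops this arc.\<close>

fun peel :: "val \<Rightarrow> val \<Rightarrow> nat \<Rightarrow> nat \<Rightarrow> cell list \<Rightarrow> cell list list" where
  "peel s t 0 m X = []"
| "peel s t (Suc k) m X =
     (let F = tl (solve (return_cell s t m # bound (Suc k) X)) in F # peel s t k m (subtract X F))"

text \<open>
  The bound exceeds every cut by at least one, so the search always ends with a minimum cut. For
  \<open>s = t\<close> the returning arc is a loop, and no bound but zero would be the value of a flow.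
\<close>

definition max_flow_cells :: "(val \<times> val \<times> val) list \<Rightarrow> val \<Rightarrow> val \<Rightarrow> cell list" where
  "max_flow_cells A s t = solve (return_cell s t (if s = t then 0 else length A + 1) # init A)"

text \<open>At value zero the second list is empty, so the truncation in \<open>n - 1\<close> does
  no harm.\<close>

definition flow_family :: "(val \<times> val \<times> val) list \<Rightarrow> val \<Rightarrow> val \<Rightarrow> cell list list" where
  "flow_family A s t =
     (let F = max_flow_cells A s t; n = amt (hd F) in
      peel s t (Suc n) n (solve (scale (Suc n) n (tl F))) @ peel s t n (n - 1) (scale (n - 1) 0 (tl F)))"

definition enc_shown :: "cell list \<Rightarrow> val" where
  "enc_shown F = enc_list (\<lambda>r. Node (nm r) (enc_rat (of_bool (amt r \<noteq> 0)))) F"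

lemma enc_rat_0_1:
  "enc_rat 0 = Node (Node Leaf Leaf) (Node Leaf (Node (Node Leaf Leaf) Leaf))"
  "enc_rat 1 = Node (Node Leaf (Node (Node Leaf Leaf) Leaf)) (Node Leaf (Node (Node Leaf Leaf) Leaf))"
  by (simp_all add: enc_rat_def enc_int_def enc_nat.simps[of "Suc 0"] enc_nat.simps[of 0] val_of_bool_def)

section \<open>Running time of the remaining functions\<close>

lemma count_computes: "computes COUNT [enc_list g ys] (unary (length ys)) (20 * (length ys + 1))"
proof (induction ys)
  case Nil
  show ?case by (rule computesI) (simp_all add: prog_def wp_simps)
next
  case (Cons y ys)
  show ?case using cost_computes[OF Cons]
    by (intro computesI) (auto simp: prog_def wp_simps wp_call_computes[OF Cons])
qed

lemma init_computes:
  "computes INIT [enc_list (\<lambda>(a, u, v). Node a (Node u v)) A] (enc_cells (init A)) (60 * (length A + 1))"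
proof (induction A)
  case Nil
  show ?case by (rule computesI) (simp_all add: prog_def wp_simps init_def)
next
  case (Cons x A)
  obtain a u v where x: "x = (a, u, v)" by (cases x)
  show ?case using cost_computes[OF Cons]
    by (intro computesI) (auto simp: x prog_def wp_simps wp_call_computes[OF Cons] init_def)
qed

lemma scale_computes:
  "computes SCALE [enc_cells X, unary k, unary u] (enc_cells (scale k u X)) (60 * (length X + 1))"
proof (induction X)
  case Nil
  show ?case by (rule computesI) (simp_all add: prog_def wp_simps scale_def)
next
  case (Cons r X)
  show ?case using cost_computes[OF Cons]
    by (intro computesI) (auto simp: prog_def wp_simps wp_call_computes[OF Cons] scale_def)
qed

lemma bound_computes:
  "computes BOUND [enc_cells X, unary k] (enc_cells (bound k X)) ((20 * (k + 1) + 80) * (length X + 1))"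
proof (induction X)
  case Nil
  show ?case by (rule computesI) (simp_all add: prog_def wp_simps bound_def)
next
  case (Cons r X)
  note l = less_computes[of "amt r" k]
  have c: "cost LESS [unary (amt r), unary k] \<le> 20 * (k + 1)"
    using cost_computes[OF l] by auto
  show ?case using cost_computes[OF Cons] c
    by (intro computesI) (auto simp: prog_def wp_simps wp_call_computes[OF Cons] wp_call_computes[OF l]
      bound_def)
qed

lemma subtract_computes:
  "length X = length F \<Longrightarrow>
   computes SUBTRACT [enc_cells X, enc_cells F] (enc_cells (subtract X F)) (100 * (length X + 1))"
proof (induction X F rule: list_induct2)
  case Nil
  show ?case by (rule computesI) (simp_all add: prog_def wp_simps subtract_def)
next
  case (Cons r X q F)
  show ?case using cost_computes[OF Cons.IH]
    by (intro computesI) (auto simp: prog_def wp_simps wp_call_computes[OF Cons.IH] subtract_def with_amt_def)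
qed

lemma show_computes: "computes SHOW [enc_cells F] (enc_shown F) (60 * (length F + 1))"
proof (induction F)
  case Nil
  show ?case by (rule computesI) (simp_all add: prog_def wp_simps enc_shown_def)
next
  case (Cons r F)
  show ?case using cost_computes[OF Cons]
    by (intro computesI) (auto simp: prog_def wp_simps wp_call_computes[OF Cons] enc_shown_def enc_rat_0_1)
qed

lemma length_solve [simp]: "length (solve X) = length X"
proof -
  have imp: "length (improve Y Z) = length Z" for Y Z by (induction Y) (auto simp: push_def split: option.split)
  have "length (repeat n Z) = length Z" for n Z by (induction n) (simp_all add: repeat_def imp)
  then show ?thesis by (simp add: solve_def)
qed

lemma length_bound [simp]: "length (bound k X) = length X"
  by (simp add: bound_def)

lemma right_of_enc_list [simp]: "right_of (enc_list e xs) = enc_list e (tl xs)"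
  by (cases xs) auto

lemma small_subtract: "small N X \<Longrightarrow> small N (subtract X F)"
  by (auto simp: small_def subtract_def small_cell_def set_zip)

lemma small_return_cell:
  assumes "\<forall>r \<in> set X. small_cell N r" "length X < N" "3 \<le> N" "val_size s \<le> N" "val_size t \<le> N" "m \<le> N"
  shows "small N (return_cell s t m # X)"
  using assms by (auto simp: small_def return_cell_def small_cell_def)

lemma small_cell_bound: "3 \<le> N \<Longrightarrow> small N X \<Longrightarrow> \<forall>r \<in> set (bound k X). small_cell N r"
  by (auto simp: small_def bound_def small_cell_def)

definition peel_bound :: "nat \<Rightarrow> nat" where
  "peel_bound N = solve_bound N + (20 * (N + 1) + 80) * (N + 1) + 160 * (N + 1) + 100"

lemma peel_computes:
  assumes "3 \<le> N" "val_size s \<le> N" "val_size t \<le> N" "m \<le> N"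
  shows "small N X \<Longrightarrow> length X < N \<Longrightarrow> k \<le> N \<Longrightarrow>
   computes PEEL [unary k, unary m, enc_cells X, Node t s, enc_list enc_shown Fs]
     (enc_list enc_shown (peel s t k m X @ Fs)) ((k + 1) * peel_bound N)"
proof (induction k arbitrary: X)
  case 0
  show ?case by (rule computesI) (simp_all add: prog_def wp_simps peel_bound_def)
next
  case (Suc k)
  let ?Z = "return_cell s t m # bound (Suc k) X"
  let ?F = "tl (solve ?Z)"
  note b = bound_computes[of X "Suc k"]
  have Z: "small N ?Z" using Suc.prems assms by (intro small_return_cell small_cell_bound) auto
  note v = solve_computes[OF Z]
  have v': "computes SOLVE [Node (Node (Node Leaf Leaf) (Node (Node t s) (Node Leaf (Node (unary m) (unary m)))))
      (enc_cells (bound (Suc k) X))] (enc_cells (solve ?Z)) (solve_bound N)"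
    using v by (simp add: return_cell_def)
  have lenF: "length X = length ?F" by simp
  note d = subtract_computes[OF lenF] and w = show_computes[of ?F]
  have IH: "computes PEEL [unary k, unary m, enc_cells (subtract X ?F), Node t s, enc_list enc_shown Fs]
     (enc_list enc_shown (peel s t k m (subtract X ?F) @ Fs)) ((k + 1) * peel_bound N)"
    using Suc.prems by (intro Suc.IH small_subtract) (auto simp: subtract_def)
  have "(20 * (Suc k + 1) + 80) * (length X + 1) \<le> (20 * (N + 1) + 80) * (N + 1)"
    using Suc.prems by (intro mult_le_mono) auto
  then have "cost BOUND [enc_cells X, Node Leaf (unary k)] \<le> (20 * (N + 1) + 80) * (N + 1)"
    using cost_computes[OF b] by simp
  moreover have "cost SUBTRACT [enc_cells X, enc_cells ?F] \<le> 100 * (N + 1)"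
    using cost_computes[OF d] Suc.prems by simp
  moreover have "cost SHOW [enc_cells ?F] \<le> 60 * (N + 1)"
    using cost_computes[OF w] Suc.prems by simp
  ultimately have "cost BOUND [enc_cells X, Node Leaf (unary k)] + cost SUBTRACT [enc_cells X, enc_cells ?F] +
      cost SHOW [enc_cells ?F] + cost SOLVE [Node (Node (Node Leaf Leaf)
        (Node (Node t s) (Node Leaf (Node (unary m) (unary m))))) (enc_cells (bound (Suc k) X))] + 100 \<le> peel_bound N"
    unfolding peel_bound_def using cost_computes[OF v'] by linarith
  then show ?case
    using cost_computes[OF IH]
    by (intro computesI) (auto simp: prog_def wp_simps Let_def wp_call_computes[OF v'] wp_call_computes[OF IH]
      wp_call_computes[OF b, simplified] wp_call_computes[OF d] wp_call_computes[OF w])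
qed

definition main_bound :: "nat \<Rightarrow> nat" where
  "main_bound N = 2 * solve_bound N + 2 * ((N + 1) * peel_bound N) + 300 * (N + 1)"

text \<open>That the flow value stays below \<open>N\<close> is a fact about the network rather than
  about the execution, so it is assumed here and supplied once the computed cells are known to be a
  maximum flow.\<close>

lemma main_eval:
  fixes A s t
  defines "n \<equiv> amt (hd (max_flow_cells A s t))"
  assumes N: "length A + 2 \<le> N" "3 \<le> N" "val_size s \<le> N" "val_size t \<le> N"
    and A: "\<And>a u v. (a, u, v) \<in> set A \<Longrightarrow> val_size a \<le> N \<and> val_size u \<le> N \<and> val_size v \<le> N"
    and n: "n < N"
  shows "\<exists>c \<le> main_bound N. eval prog
    [Node VS (Node (enc_list (\<lambda>(a, u, v). Node a (Node u v)) A) (Node s t))] main_expr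
    (enc_list enc_shown (flow_family A s t)) c"
proof -
  let ?b = "if s = t then 0 else length A + 1"
  let ?Z = "return_cell s t ?b # init A"
  define F where "F = solve ?Z"
  have F: "max_flow_cells A s t = F" by (simp add: F_def max_flow_cells_def)
  have nF: "amt (hd F) = n" by (simp add: n_def F)
  have "\<forall>r \<in> set (init A). small_cell N r" using A N by (fastforce simp: init_def small_cell_def)
  then have Z: "small N ?Z" using N by (intro small_return_cell) (auto simp: init_def)
  have smallF: "small N F" unfolding F_def by (rule small_solve[OF Z])
  have lenF: "length F = length A + 1" by (simp add: F_def init_def)
  have Fne: "F \<noteq> []" using lenF by auto
  have small_scale: "small N (scale k u (tl F))" if "u \<le> N" for k u
    using smallF that Fne by (auto simp: small_def scale_def small_cell_def dest: list.set_sel(2))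
  have len_scale: "length (scale k u (tl F)) < N" for k u using lenF N by (simp add: scale_def)
  note v = solve_computes[OF Z, folded F_def]
  let ?X1 = "scale (Suc n) n (tl F)" and ?X2 = "scale (n - Suc 0) 0 (tl F)"
  let ?P2 = "peel s t n (n - Suc 0) ?X2"
  have s1: "computes SCALE [enc_cells (tl F), Node Leaf (unary n), unary n] (enc_cells ?X1) (60 * (N + 1))"
    using computes_mono[OF scale_computes[of "tl F" "Suc n" n]] lenF N by simp
  have s2: "computes SCALE [enc_cells (tl F), unary (n - Suc 0), Leaf] (enc_cells ?X2) (60 * (N + 1))"
    using computes_mono[OF scale_computes[of "tl F" "n - Suc 0" 0]] lenF N by simp
  have w: "computes SOLVE [enc_cells ?X1] (enc_cells (solve ?X1)) (solve_bound N)"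
    using n by (intro solve_computes small_scale) simp
  have le: "(n + 1) * peel_bound N \<le> (N + 1) * peel_bound N" "(Suc n + 1) * peel_bound N \<le> (N + 1) * peel_bound N"
    using n by (intro mult_le_mono1, simp)+
  have "computes PEEL [unary n, unary (n - Suc 0), enc_cells ?X2, Node t s, enc_list enc_shown []]
     (enc_list enc_shown (?P2 @ [])) ((n + 1) * peel_bound N)"
    using n N by (intro peel_computes small_scale len_scale) auto
  from computes_mono[OF this le(1)] have p2: "computes PEEL
     [unary n, unary (n - Suc 0), enc_cells ?X2, Node t s, Leaf] (enc_list enc_shown ?P2) ((N + 1) * peel_bound N)"
    by simp
  have "computes PEEL [unary (Suc n), unary n, enc_cells (solve ?X1), Node t s, enc_list enc_shown ?P2]
     (enc_list enc_shown (peel s t (Suc n) n (solve ?X1) @ ?P2)) ((Suc n + 1) * peel_bound N)"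
    using n N len_scale by (intro peel_computes small_solve small_scale) auto
  from computes_mono[OF this le(2)] have p1: "computes PEEL
     [Node Leaf (unary n), unary n, enc_cells (solve ?X1), Node t s, enc_list enc_shown ?P2]
     (enc_list enc_shown (flow_family A s t)) ((N + 1) * peel_bound N)"
    by (simp add: flow_family_def F nF Let_def del: peel.simps)
  have hd: "left_of (right_of (right_of (left_of (enc_cells F)))) = unary n" using Fne nF by (cases F) auto
  have c: "computes COUNT [enc_list (\<lambda>(a, u, v). Node a (Node u v)) A] (unary (length A)) (20 * (N + 1))"
    by (rule computes_mono[OF count_computes]) (use N in simp)
  have i: "computes INIT [enc_list (\<lambda>(a, u, v). Node a (Node u v)) A] (enc_cells (init A)) (60 * (N + 1))"
    by (rule computes_mono[OF init_computes]) (use N in simp)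
  note rules = wp_simps wp_call_computes[OF c] wp_call_computes[OF i] wp_call_computes[OF s1]
    wp_call_computes[OF s2] wp_call_computes[OF w] wp_call_computes[OF p1] wp_call_computes[OF p2] hd
  note costs = cost_computes[OF c] cost_computes[OF i] cost_computes[OF s1] cost_computes[OF s2]
    cost_computes[OF w] cost_computes[OF p1] cost_computes[OF p2]
  have "wp [Node VS (Node (enc_list (\<lambda>(a, u, v). Node a (Node u v)) A) (Node s t))] main_expr
      (\<lambda>v c. v = enc_list enc_shown (flow_family A s t) \<and> c \<le> main_bound N)"
  proof (cases "s = t")
    case True
    have v': "computes SOLVE [Node (Node (Node Leaf Leaf) (Node (Node t t) (Node Leaf (Node Leaf Leaf))))
      (enc_cells (init A))] (enc_cells F) (solve_bound N)" using v True by (simp add: return_cell_def)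
    show ?thesis using costs cost_computes[OF v'] N(3,4)
      by (simp add: main_expr_def rules[unfolded True] wp_call_computes[OF v'] main_bound_def True)
  next
    case False
    have v': "computes SOLVE [Node (Node (Node Leaf Leaf) (Node (Node t s)
        (Node Leaf (Node (Node Leaf (unary (length A))) (Node Leaf (unary (length A)))))))
      (enc_cells (init A))] (enc_cells F) (solve_bound N)" using v False by (simp add: return_cell_def)
    show ?thesis using costs cost_computes[OF v'] N(3,4) False False[symmetric]
      by (simp add: main_expr_def rules wp_call_computes[OF v'] main_bound_def)
  qed
  then show ?thesis unfolding wp_def by blast
qed

section \<open>Polynomial bounds\<close>

definition poly_bounded :: "(nat \<Rightarrow> nat) \<Rightarrow> bool" where
  "poly_bounded f \<longleftrightarrow> (\<exists>q :: nat poly. \<forall>n. f n \<le> poly q n)"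

lemma poly_bounded_intros:
  "poly_bounded (\<lambda>n. c)"
  "poly_bounded (\<lambda>n. n)"
  "poly_bounded f \<Longrightarrow> poly_bounded g \<Longrightarrow> poly_bounded (\<lambda>n. f n + g n)"
  "poly_bounded f \<Longrightarrow> poly_bounded g \<Longrightarrow> poly_bounded (\<lambda>n. f n * g n)"
proof -
  show "poly_bounded (\<lambda>n. c)" unfolding poly_bounded_def by (rule exI[of _ "[:c:]"]) simp
  show "poly_bounded (\<lambda>n. n)" unfolding poly_bounded_def by (rule exI[of _ "[:0, 1:]"]) simp
  assume "poly_bounded f" "poly_bounded g"
  then obtain p q where "\<forall>n. f n \<le> poly p n" "\<forall>n. g n \<le> poly q n" unfolding poly_bounded_def by blast
  then have "\<forall>n. f n + g n \<le> poly (p + q) n" "\<forall>n. f n * g n \<le> poly (p * q) n"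
    by (simp_all add: add_le_mono mult_le_mono)
  then show "poly_bounded (\<lambda>n. f n + g n)" "poly_bounded (\<lambda>n. f n * g n)"
    unfolding poly_bounded_def by blast+
qed

text \<open>The shift by 3 accommodates the name of the return arc, a tree of size 3.\<close>

lemma poly_bounded_main_bound: "poly_bounded (\<lambda>n. main_bound (n + 3))"
  unfolding main_bound_def peel_bound_def solve_bound_def improve_bound_def push_bound_def find_bound_def
    visit_bound_def table_bound_def
  by (intro poly_bounded_intros)

lemma length_less_val_size: "length xs < val_size (enc_list e xs)"
  by (induction xs) auto

lemma val_size_member: "x \<in> set xs \<Longrightarrow> val_size (e x) \<le> val_size (enc_list e xs)"
  by (induction xs) auto

text \<open>Pigeonhole: with fewer units than flows, some flow avoids the arc.\<close>

lemma sum_list_zero_member: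
  "(\<Sum>f\<leftarrow>fs. f a) < length fs \<Longrightarrow> \<exists>f \<in> set fs. f a = (0 :: nat)"
proof (rule ccontr)
  assume less: "(\<Sum>f\<leftarrow>fs. f a) < length fs" and "\<not> (\<exists>f \<in> set fs. f a = 0)"
  then have "\<And>f. f \<in> set fs \<Longrightarrow> 1 \<le> f a" by force
  then have "(\<Sum>f\<leftarrow>fs. 1) \<le> (\<Sum>f\<leftarrow>fs. f a)" by (rule sum_list_mono)
  then show False using less by (simp add: sum_list_triv)
qed

section \<open>Solved cell lists as functions on an index set\<close>

definition indexed_cells ::
  "('i \<Rightarrow> val \<times> val \<times> val) \<Rightarrow> 'i list \<Rightarrow> ('i \<Rightarrow> nat) \<Rightarrow> ('i \<Rightarrow> nat) \<Rightarrow> ('i \<Rightarrow> nat) \<Rightarrow> cell list" where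
  "indexed_cells w I x l h =
     map (\<lambda>i. case w i of (n, u, v) \<Rightarrow> Cell n u v (x i) (l i) (h i)) I"

lemma closer_indexed_cells:
  assumes "list_all2 closer (indexed_cells w I x l h) Y" "distinct I"
  shows "\<exists>y. Y = indexed_cells w I y l h \<and> (\<forall>i \<in> set I. min (l i) (x i) \<le> y i \<and> y i \<le> max (h i) (x i))"
  using assms
proof (induction I arbitrary: Y)
  case Nil
  then show ?case by (simp add: indexed_cells_def)
next
  case (Cons i I)
  obtain n u v where w: "w i = (n, u, v)" by (cases "w i")
  from Cons.prems(1) obtain r Y' where Y: "Y = r # Y'" "closer (Cell n u v (x i) (l i) (h i)) r"
      "list_all2 closer (indexed_cells w I x l h) Y'"
    by (auto simp: indexed_cells_def list_all2_Cons1 w)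
  then obtain y where y: "Y' = indexed_cells w I y l h"
      "\<forall>i \<in> set I. min (l i) (x i) \<le> y i \<and> y i \<le> max (h i) (x i)"
    using Cons.IH Cons.prems(2) by auto
  have r: "r = Cell n u v (amt r) (l i) (h i)" "min (l i) (x i) \<le> amt r" "amt r \<le> max (h i) (x i)"
    using Y(2) by (auto simp: closer_def with_amt_def)
  have "Y = indexed_cells w (i # I) (y(i := amt r)) l h"
    using Y(1) y(1) r(1) Cons.prems(2) w by (auto simp: indexed_cells_def)
  moreover have "\<forall>j \<in> set (i # I). min (l j) (x j) \<le> (y(i := amt r)) j \<and> (y(i := amt r)) j \<le> max (h j) (x j)"
    using y(2) r(2,3) by simp
  ultimately show ?case by blast
qed

text \<open>The three conclusions of \<open>solve_spec\<close>, restated for amounts as functions of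
  the index. Names and end points stay fixed in \<open>w\<close>, so arcs with and without a return
  arc are treated alike.\<close>

definition settled :: "('i \<Rightarrow> val \<times> val \<times> val) \<Rightarrow> 'i list \<Rightarrow> ('i \<Rightarrow> nat) \<Rightarrow> ('i \<Rightarrow> nat) \<Rightarrow>
    ('i \<Rightarrow> nat) \<Rightarrow> ('i \<Rightarrow> nat) \<Rightarrow> bool" where
  "settled w I l h x y \<longleftrightarrow>
     (\<forall>i \<in> set I. min (l i) (x i) \<le> y i \<and> y i \<le> max (h i) (x i)) \<and>
     (\<forall>S. (\<Sum>i \<in> set I. int (y i) * (of_bool (snd (snd (w i)) \<in> S) - of_bool (fst (snd (w i)) \<in> S))) =
       (\<Sum>i \<in> set I. int (x i) * (of_bool (snd (snd (w i)) \<in> S) - of_bool (fst (snd (w i)) \<in> S)))) \<and>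
     (\<forall>i \<in> set I. y i < l i \<or> h i < y i \<longrightarrow>
       (\<exists>S. (if y i < l i then snd (snd (w i)) \<in> S \<and> fst (snd (w i)) \<notin> S
           else fst (snd (w i)) \<in> S \<and> snd (snd (w i)) \<notin> S) \<and>
        (\<forall>j \<in> set I. (fst (snd (w j)) \<in> S \<longrightarrow> snd (snd (w j)) \<notin> S \<longrightarrow> h j \<le> y j) \<and>
           (snd (snd (w j)) \<in> S \<longrightarrow> fst (snd (w j)) \<notin> S \<longrightarrow> y j \<le> l j))))"

lemma solve_indexed_cells:
  assumes "distinct I" "inj_on (fst \<circ> w) (set I)" "\<forall>i \<in> set I. l i \<le> h i"
    and "(\<Sum>i \<in> set I. (l i - x i) + (x i - h i)) \<le> 2 * length I"
  shows "\<exists>y. solve (indexed_cells w I x l h) = indexed_cells w I y l h \<and> settled w I l h x y"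
proof -
  define c where "c z i = Cell (fst (w i)) (fst (snd (w i))) (snd (snd (w i))) (z i) (l i) (h i)" for z i
  have cells: "indexed_cells w I z l h = map (c z) I" for z
    by (simp add: indexed_cells_def c_def case_prod_beta)
  have "map nm (map (c x) I) = map (fst \<circ> w) I" by (simp add: c_def)
  moreover have "distinct (map (fst \<circ> w) I)" using assms(1,2) by (simp add: distinct_map)
  ultimately have "distinct (map nm (map (c x) I))" by (simp only:)
  then have con: "consistent (map (c x) I)"
    using assms(3) unfolding consistent_def by (simp add: c_def)
  have vio: "(\<Sum>q\<leftarrow>map (c x) I. violation q) \<le> 2 * length (map (c x) I)"
    using assms(4,1) by (simp add: violation_def c_def o_def sum_list_distinct_conv_sum_set)
  note sp = solve_spec[OF con vio]
  obtain y where y: "solve (map (c x) I) = indexed_cells w I y l h"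
     "\<forall>i \<in> set I. min (l i) (x i) \<le> y i \<and> y i \<le> max (h i) (x i)"
    using closer_indexed_cells[OF sp(1)[folded cells] assms(1)] unfolding cells by blast
  have sum: "\<forall>S. (\<Sum>i \<in> set I. int (y i) * (of_bool (snd (snd (w i)) \<in> S) - of_bool (fst (snd (w i)) \<in> S))) =
      (\<Sum>i \<in> set I. int (x i) * (of_bool (snd (snd (w i)) \<in> S) - of_bool (fst (snd (w i)) \<in> S)))"
    using sp(2) assms(1) unfolding y(1) unfolding cells
    by (simp add: net_def c_def o_def sum_list_distinct_conv_sum_set)
  have "stuck (map (c y) I)" using sp(3) unfolding y(1) cells .
  then have "settled w I l h x y"
    unfolding settled_def using y(2) sum
    by (simp only: stuck_def set_map ball_simps c_def cell.sel closed_under_def simp_thms)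
  then show ?thesis using y(1) unfolding cells by blast
qed

section \<open>Flows and cuts\<close>

lemma enc_nat_0: "enc_nat 0 = Leaf"
  using enc_nat.simps[of 0] by simp

lemma enc_nat_pos: "n \<noteq> 0 \<Longrightarrow> enc_nat n = Node (val_of_bool (odd n)) (enc_nat (n div 2))"
  using enc_nat.simps[of n] by simp

lemma enc_nat_inject: "enc_nat m = enc_nat n \<Longrightarrow> m = n"
proof (induction m arbitrary: n rule: less_induct)
  case (less m)
  show ?case
  proof (cases "m = 0 \<or> n = 0")
    case True
    then show ?thesis using less.prems by (metis enc_nat_0 enc_nat_pos val.distinct(1))
  next
    case False
    then have eq: "val_of_bool (odd m) = val_of_bool (odd n)" "enc_nat (m div 2) = enc_nat (n div 2)"
      using less.prems by (simp_all add: enc_nat_pos)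
    have "m div 2 = n div 2" using less.IH[OF _ eq(2)] False by simp
    moreover have "odd m = odd n" using eq(1) by (simp add: val_of_bool_def split: if_splits)
    ultimately show ?thesis by (metis odd_two_times_div_two_succ dvd_mult_div_cancel)
  qed
qed

lemma enc_nat_eq_iff [simp]: "enc_nat m = enc_nat n \<longleftrightarrow> m = n"
  using enc_nat_inject by blast

lemma enc_nat_neq_one: "enc_nat n \<noteq> Node Leaf Leaf"
proof
  assume a: "enc_nat n = Node Leaf Leaf"
  then have n: "n \<noteq> 0" by (metis enc_nat_0 val.distinct(1))
  then have "even n" "enc_nat (n div 2) = enc_nat 0" using a by (simp_all add: enc_nat_pos enc_nat_0)
  then show False using n enc_nat_inject by fastforce
qed

section \<open>Balances of vertex sets\<close>

locale network = fin_digraph G for G :: "(nat, nat) pre_digraph" +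
  fixes es :: "nat list" and s t :: nat
  assumes es: "enumerates es (arcs G)" and s_in: "s \<in> verts G" and t_in: "t \<in> verts G"
begin

lemma distinct_es: "distinct es" and set_es [simp]: "set es = arcs G"
  using es by (auto simp: enumerates_def)

lemma card_arcs: "card (arcs G) = length es"
  using distinct_card[OF distinct_es] by simp

definition outward :: "nat set \<Rightarrow> nat set" where
  "outward T = {a \<in> arcs G. tail G a \<in> T \<and> head G a \<notin> T}"

definition inward :: "nat set \<Rightarrow> nat set" where
  "inward T = {a \<in> arcs G. head G a \<in> T \<and> tail G a \<notin> T}"

text \<open>The counterpart of \<open>net\<close> for real functions on arcs. A flow of value
  \<open>m\<close> satisfies \<open>balance g T = st_balance m T\<close> for all \<open>T\<close>.
  Both sides are linear, so scaling and subtracting flows become simple algebra.\<close>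

definition balance :: "(nat \<Rightarrow> real) \<Rightarrow> nat set \<Rightarrow> real" where
  "balance g T = (\<Sum>a \<in> arcs G. g a * (of_bool (head G a \<in> T) - of_bool (tail G a \<in> T)))"

definition st_balance :: "real \<Rightarrow> nat set \<Rightarrow> real" where
  "st_balance m T = m * (of_bool (t \<in> T) - of_bool (s \<in> T))"

lemma finite_outward [simp]: "finite (outward T)" and finite_inward [simp]: "finite (inward T)"
  by (simp_all add: outward_def inward_def)

lemma balance_cut: "balance g T = (\<Sum>a \<in> inward T. g a) - (\<Sum>a \<in> outward T. g a)"
proof -
  have "balance g T = (\<Sum>a \<in> arcs G. (if head G a \<in> T \<and> tail G a \<notin> T then g a else 0) -
      (if tail G a \<in> T \<and> head G a \<notin> T then g a else 0))"
    unfolding balance_def by (rule sum.cong) auto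
  also have "\<dots> = (\<Sum>a \<in> inward T. g a) - (\<Sum>a \<in> outward T. g a)"
    unfolding sum_subtractf inward_def outward_def by (simp add: sum.inter_filter)
  finally show ?thesis .
qed

lemma balance_vertex: "balance g {v} = (\<Sum>a \<in> in_arcs G v. g a) - (\<Sum>a \<in> out_arcs G v. g a)"
proof -
  have "(\<Sum>a \<in> in_arcs G v. g a) = (\<Sum>a \<in> arcs G. g a * of_bool (head G a \<in> {v}))"
    unfolding in_arcs_def by (simp add: sum.inter_filter of_bool_def if_distrib cong: if_cong)
  moreover have "(\<Sum>a \<in> out_arcs G v. g a) = (\<Sum>a \<in> arcs G. g a * of_bool (tail G a \<in> {v}))"
    unfolding out_arcs_def by (simp add: sum.inter_filter of_bool_def if_distrib cong: if_cong)
  ultimately show ?thesis by (simp add: balance_def right_diff_distrib sum_subtractf)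
qed

lemma flow_value_balance: "flow_value G s g = - balance g {s}"
  by (simp add: flow_value_def balance_vertex)

lemma balance_sum: "balance g T = (\<Sum>v \<in> verts G \<inter> T. balance g {v})"
proof -
  have fin: "finite (verts G \<inter> T)" by simp
  have "(\<Sum>v \<in> verts G \<inter> T. balance g {v}) = (\<Sum>a \<in> arcs G. \<Sum>v \<in> verts G \<inter> T.
      g a * (of_bool (head G a \<in> {v}) - of_bool (tail G a \<in> {v})))"
    unfolding balance_def by (rule sum.swap)
  also have "\<dots> = balance g T"
    unfolding balance_def
  proof (rule sum.cong[OF refl])
    fix a assume a: "a \<in> arcs G"
    have "(\<Sum>v \<in> verts G \<inter> T. of_bool (u \<in> {v}) :: real) = of_bool (u \<in> T)" if "u \<in> verts G" for u
      using that fin by (simp add: of_bool_def sum.delta')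
    then show "(\<Sum>v \<in> verts G \<inter> T. g a * (of_bool (head G a \<in> {v}) - of_bool (tail G a \<in> {v}))) =
        g a * (of_bool (head G a \<in> T) - of_bool (tail G a \<in> T))"
      using a by (simp add: sum_distrib_left[symmetric] sum_subtractf)
  qed
  finally show ?thesis by simp
qed

text \<open>Only the terminals contribute to the sum over vertices, and the sum over all vertices
  vanishes, which ties \<open>t\<close> to \<open>s\<close>. For \<open>s = t\<close> it forces
  value zero.\<close>

lemma flow_balance:
  assumes "st_flow G s t g"
  shows "balance g T = st_balance (flow_value G s g) T"
proof -
  have zero: "balance g {v} = 0" if "v \<in> verts G - {s, t}" for v
    using assms that by (simp add: st_flow_def balance_vertex)
  have sum: "balance g T' = (\<Sum>v \<in> {s, t} \<inter> T'. balance g {v})" for T'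
    unfolding balance_sum[of g T'] using s_in t_in zero
    by (intro sum.mono_neutral_right) auto
  have "balance g UNIV = 0" by (simp add: balance_def)
  then have st: "s \<noteq> t \<Longrightarrow> balance g {t} = - balance g {s}" "s = t \<Longrightarrow> balance g {s} = 0"
    using sum[of UNIV] by auto
  show ?thesis
  proof (cases "s = t")
    case True
    have "{s, t} \<inter> T \<subseteq> {s}" using True by blast
    then have "{s, t} \<inter> T = {} \<or> {s, t} \<inter> T = {s}" by blast
    then have "balance g T = 0" using sum[of T] st(2)[OF True] by auto
    then show ?thesis unfolding st_balance_def using True by simp
  next
    case False
    then show ?thesis
      unfolding st_balance_def flow_value_balance sum[of T] using st(1)
      by (cases "s \<in> T"; cases "t \<in> T") simp_all
  qed
qed

text \<open>For \<open>s = t\<close> the function \<open>st_balance m\<close> is zero whatever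
  \<open>m\<close> is, so the value has to be fixed by a separate condition.\<close>

lemma balance_flow:
  assumes "\<And>T. balance g T = st_balance m T" "\<And>a. a \<in> arcs G \<Longrightarrow> 0 \<le> g a \<and> g a \<le> 1"
    "\<And>a. a \<notin> arcs G \<Longrightarrow> g a = 0" "s = t \<Longrightarrow> m = 0"
  shows "st_flow G s t g" "flow_value G s g = m"
proof -
  show "flow_value G s g = m" using assms(1)[of "{s}"] assms(4) by (auto simp: flow_value_balance st_balance_def)
  have "balance g {v} = 0" if "v \<in> verts G - {s, t}" for v using assms(1)[of "{v}"] that by (simp add: st_balance_def)
  then show "st_flow G s t g" using assms(2,3) by (auto simp: st_flow_def balance_vertex)
qed

lemma flow_value_le_cut:
  assumes "st_flow G s t g" "s \<in> T" "t \<notin> T"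
  shows "flow_value G s g \<le> (\<Sum>a \<in> outward T. g a)"
proof -
  have "0 \<le> (\<Sum>a \<in> inward T. g a)" using assms(1) by (intro sum_nonneg) (auto simp: st_flow_def inward_def)
  then show ?thesis using flow_balance[OF assms(1), of T] balance_cut[of g T] assms(2,3) by (simp add: st_balance_def)
qed

lemma flow_value_eq_0: "s = t \<Longrightarrow> st_flow G s t g \<Longrightarrow> flow_value G s g = 0"
  unfolding flow_value_balance using flow_balance[of g "{s}"] unfolding st_balance_def by simp

text \<open>Optimality after the deletion becomes optimality among the flows of \<open>G\<close>
  that vanish on \<open>e\<close>, so all later arguments stay in one network.\<close>

lemma del_arc_flow:
  shows "st_flow (del_arc e) s t g \<longleftrightarrow> st_flow G s t g \<and> g e = 0"
    and "g e = 0 \<Longrightarrow> flow_value (del_arc e) s g = flow_value G s g"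
proof -
  have arcs: "in_arcs (del_arc e) v = in_arcs G v - {e}" "out_arcs (del_arc e) v = out_arcs G v - {e}" for v
    by (auto simp: in_arcs_def out_arcs_def)
  have sum: "(\<Sum>a \<in> A - {e}. g a) = (\<Sum>a \<in> A. g a)" if "g e = 0" "finite A" for A
    using that by (intro sum.mono_neutral_left) auto
  have fin: "finite (in_arcs G v)" "finite (out_arcs G v)" for v by (simp_all add: in_arcs_def out_arcs_def)
  show "g e = 0 \<Longrightarrow> flow_value (del_arc e) s g = flow_value G s g"
    by (simp add: flow_value_def arcs sum fin)
  show "st_flow (del_arc e) s t g \<longleftrightarrow> st_flow G s t g \<and> g e = 0"
  proof (cases "g e = 0")
    case True
    have "(\<forall>a. a \<notin> arcs G - {e} \<longrightarrow> g a = 0) \<longleftrightarrow> (\<forall>a. a \<notin> arcs G \<longrightarrow> g a = 0)"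
      "(\<forall>a \<in> arcs G - {e}. 0 \<le> g a \<and> g a \<le> 1) \<longleftrightarrow> (\<forall>a \<in> arcs G. 0 \<le> g a \<and> g a \<le> 1)"
      using True by auto
    then show ?thesis using True by (simp add: st_flow_def arcs sum fin del: Diff_iff)
  next
    case False
    then show ?thesis by (auto simp: st_flow_def)
  qed
qed

section \<open>Networks as cell lists\<close>

definition arc_key :: "nat \<Rightarrow> val \<times> val \<times> val" where
  "arc_key a = (enc_nat a, enc_nat (tail G a), enc_nat (head G a))"

definition arc_cells :: "(nat \<Rightarrow> nat) \<Rightarrow> (nat \<Rightarrow> nat) \<Rightarrow> (nat \<Rightarrow> nat) \<Rightarrow> cell list" where
  "arc_cells x l h = indexed_cells arc_key es x l h"

lemma arc_cells_eq:
  "arc_cells x l h =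
     map (\<lambda>a. Cell (enc_nat a) (enc_nat (tail G a)) (enc_nat (head G a)) (x a) (l a) (h a)) es"
  by (simp add: arc_cells_def indexed_cells_def arc_key_def)

definition blocking :: "(nat \<Rightarrow> nat) \<Rightarrow> (nat \<Rightarrow> nat) \<Rightarrow> (nat \<Rightarrow> nat) \<Rightarrow> nat set \<Rightarrow> bool" where
  "blocking y l h T \<longleftrightarrow> (\<forall>c \<in> outward T. h c \<le> y c) \<and> (\<forall>c \<in> inward T. y c \<le> l c)"

text \<open>Without a return arc the repair reroutes units and keeps every balance, hence also the
  value. This is the form in which loads are lowered.\<close>

lemma solve_arc_cells:
  assumes "\<forall>a \<in> arcs G. l a \<le> h a" "(\<Sum>a \<in> arcs G. (l a - x a) + (x a - h a)) \<le> 2 * length es"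
  shows "\<exists>y. solve (arc_cells x l h) = arc_cells y l h \<and>
    (\<forall>a \<in> arcs G. y a \<le> max (h a) (x a)) \<and>
    (\<forall>T. balance (\<lambda>a. real (y a)) T = balance (\<lambda>a. real (x a)) T) \<and>
    (\<forall>a \<in> arcs G. l a \<le> y a \<longrightarrow> h a < y a \<longrightarrow> (\<exists>T. a \<in> outward T \<and> blocking y l h T))"
proof -
  have inj: "inj_on (fst \<circ> arc_key) (set es)" by (auto simp: inj_on_def arc_key_def)
  obtain y where y: "solve (indexed_cells arc_key es x l h) = indexed_cells arc_key es y l h"
    "settled arc_key es l h x y"
    using solve_indexed_cells[OF distinct_es inj, of l h x] assms by auto
  note bd = y(2)[unfolded settled_def, THEN conjunct1, rule_format]
    and net = y(2)[unfolded settled_def, THEN conjunct2, THEN conjunct1, rule_format]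
    and st = y(2)[unfolded settled_def, THEN conjunct2, THEN conjunct2, rule_format]
  \<comment> \<open>Cells carry encoded vertices. By injectivity of \<open>enc_nat\<close> a vertex
    set can be replaced by its image.\<close>
  have int_balance: "balance (\<lambda>a. real (z a)) T = of_int (\<Sum>a \<in> set es. int (z a) *
      (of_bool (snd (snd (arc_key a)) \<in> enc_nat ` T) - of_bool (fst (snd (arc_key a)) \<in> enc_nat ` T)))" for z T
    by (auto simp: balance_def arc_key_def image_iff intro!: sum.cong)
  show ?thesis
  proof (intro exI[of _ y] conjI ballI allI impI)
    show "solve (arc_cells x l h) = arc_cells y l h" by (simp add: arc_cells_def y(1))
    show "y a \<le> max (h a) (x a)" if "a \<in> arcs G" for a using bd[of a] that by simp
    show "balance (\<lambda>a. real (y a)) T = balance (\<lambda>a. real (x a)) T" for T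
      unfolding int_balance net ..
    show "\<exists>T. a \<in> outward T \<and> blocking y l h T"
      if "a \<in> arcs G" "l a \<le> y a" "h a < y a" for a
    proof -
      have "\<not> y a < l a" using that by simp
      then have "\<exists>S. enc_nat (tail G a) \<in> S \<and> enc_nat (head G a) \<notin> S \<and>
        (\<forall>b \<in> arcs G. (enc_nat (tail G b) \<in> S \<longrightarrow> enc_nat (head G b) \<notin> S \<longrightarrow> h b \<le> y b) \<and>
           (enc_nat (head G b) \<in> S \<longrightarrow> enc_nat (tail G b) \<notin> S \<longrightarrow> y b \<le> l b))"
        using st[of a] that by (simp add: arc_key_def)
      then obtain S where S: "enc_nat (tail G a) \<in> S" "enc_nat (head G a) \<notin> S"
        "\<forall>b \<in> arcs G. (enc_nat (tail G b) \<in> S \<longrightarrow> enc_nat (head G b) \<notin> S \<longrightarrow> h b \<le> y b) \<and>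
           (enc_nat (head G b) \<in> S \<longrightarrow> enc_nat (tail G b) \<notin> S \<longrightarrow> y b \<le> l b)"
        by blast
      then show ?thesis
        using that(1) by (intro exI[of _ "{v. enc_nat v \<in> S}"]) (auto simp: blocking_def outward_def inward_def)
    qed
  qed
qed

definition return_key :: "nat option \<Rightarrow> val \<times> val \<times> val" where
  "return_key = case_option (Node Leaf Leaf, enc_nat t, enc_nat s) arc_key"

text \<open>With all amounts zero only lower bounds are violated. Raising the return arc augments an
  \<open>(s,t)\<close>-flow, and its final amount is the value \<open>m\<close>. The certificate of
  an ordinary arc may also be left by the return arc; being closed then means that the return arc is
  full, whence \<open>b \<le> m\<close>.\<close>

lemma solve_return_cell:
  assumes "\<forall>a \<in> arcs G. l a \<le> h a" "b + (\<Sum>a \<in> arcs G. l a) \<le> 2 * length es + 2"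
  shows "\<exists>m y. solve (return_cell (enc_nat s) (enc_nat t) b # arc_cells (\<lambda>_. 0) l h) =
       with_amt (return_cell (enc_nat s) (enc_nat t) b) m # arc_cells y l h \<and> m \<le> b \<and>
    (\<forall>a \<in> arcs G. y a \<le> h a) \<and> (\<forall>T. balance (\<lambda>a. real (y a)) T = st_balance m T) \<and>
    (m < b \<longrightarrow> (\<exists>T. s \<in> T \<and> t \<notin> T \<and> blocking y l h T)) \<and>
    (\<forall>a \<in> arcs G. y a < l a \<longrightarrow> (\<exists>T. a \<in> inward T \<and> blocking y l h T \<and> (t \<in> T \<longrightarrow> s \<notin> T \<longrightarrow> b \<le> m)))"
proof -
  let ?I = "None # map Some es" and ?w = return_key
  let ?l = "case_option b l" and ?h = "case_option b h"
  have split: "(\<Sum>i \<in> set ?I. F i) = F None + (\<Sum>a \<in> arcs G. F (Some a))" for F :: "nat option \<Rightarrow> 'z::comm_monoid_add"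
    by (simp add: sum.reindex)
  have dI: "distinct ?I" using distinct_es by (simp add: distinct_map)
  have inj: "inj_on (fst \<circ> ?w) (set ?I)"
    using enc_nat_neq_one by (auto simp: inj_on_def return_key_def arc_key_def) (metis)+
  have h2: "(\<Sum>i \<in> set ?I. (?l i - 0) + (0 - ?h i)) \<le> 2 * length ?I" unfolding split using assms(2) by simp
  have h1: "\<forall>i \<in> set ?I. ?l i \<le> ?h i" using assms(1) by auto
  obtain z where z: "solve (indexed_cells ?w ?I (\<lambda>_. 0) ?l ?h) = indexed_cells ?w ?I z ?l ?h"
    "settled ?w ?I ?l ?h (\<lambda>_. 0) z"
    using solve_indexed_cells[OF dI inj h1 h2] by blast
  note bd = z(2)[unfolded settled_def, THEN conjunct1, rule_format]
    and net = z(2)[unfolded settled_def, THEN conjunct2, THEN conjunct1, rule_format]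
    and st = z(2)[unfolded settled_def, THEN conjunct2, THEN conjunct2, rule_format]
  define y where "y = (\<lambda>a. z (Some a))"
  have cells: "indexed_cells ?w ?I u ?l ?h =
      with_amt (return_cell (enc_nat s) (enc_nat t) b) (u None) # arc_cells (\<lambda>a. u (Some a)) l h" for u
    by (simp add: indexed_cells_def return_key_def arc_cells_def return_cell_def with_amt_def)
  have st': "\<exists>T. (case i of None \<Rightarrow> s \<in> T \<and> t \<notin> T | Some a \<Rightarrow> a \<in> inward T) \<and>
        blocking y l h T \<and> (t \<in> T \<longrightarrow> s \<notin> T \<longrightarrow> b \<le> z None)"
    if i: "i \<in> set ?I" "z i < ?l i" for i
  proof -
    from st[OF i(1) disjI1[OF i(2)]] obtain S where S: "snd (snd (?w i)) \<in> S" "fst (snd (?w i)) \<notin> S"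
      and S': "\<And>j. j \<in> set ?I \<Longrightarrow> (fst (snd (?w j)) \<in> S \<longrightarrow> snd (snd (?w j)) \<notin> S \<longrightarrow> ?h j \<le> z j) \<and>
           (snd (snd (?w j)) \<in> S \<longrightarrow> fst (snd (?w j)) \<notin> S \<longrightarrow> z j \<le> ?l j)"
      unfolding if_P[OF i(2)] by blast
    have "case i of None \<Rightarrow> enc_nat s \<in> S \<and> enc_nat t \<notin> S | Some a \<Rightarrow> enc_nat (head G a) \<in> S \<and> enc_nat (tail G a) \<notin> S"
      using S by (simp add: return_key_def arc_key_def split: option.splits)
    moreover have "(enc_nat (tail G c) \<in> S \<longrightarrow> enc_nat (head G c) \<notin> S \<longrightarrow> h c \<le> y c) \<and>
        (enc_nat (head G c) \<in> S \<longrightarrow> enc_nat (tail G c) \<notin> S \<longrightarrow> y c \<le> l c)" if "c \<in> arcs G" for c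
      using S'[of "Some c"] that by (simp add: return_key_def arc_key_def y_def)
    moreover have "enc_nat t \<in> S \<longrightarrow> enc_nat s \<notin> S \<longrightarrow> b \<le> z None"
      using S'[of None] by (simp add: return_key_def)
    ultimately show ?thesis
      using i(1) by (intro exI[of _ "{v. enc_nat v \<in> S}"]) (auto simp: blocking_def outward_def inward_def split: option.splits)
  qed
  show ?thesis
  proof (intro exI[of _ "z None"] exI[of _ y] conjI ballI allI impI)
    show "solve (return_cell (enc_nat s) (enc_nat t) b # arc_cells (\<lambda>_. 0) l h) =
       with_amt (return_cell (enc_nat s) (enc_nat t) b) (z None) # arc_cells y l h"
      using z(1) unfolding cells by (simp add: y_def return_cell_def with_amt_def)
    show "z None \<le> b" using bd[of None] by simp
    show "y a \<le> h a" if "a \<in> arcs G" for a using bd[of "Some a"] that by (simp add: y_def)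
    show "balance (\<lambda>a. real (y a)) T = st_balance (z None) T" for T
    proof -
      have "int (z None) * (of_bool (s \<in> T) - of_bool (t \<in> T)) +
         (\<Sum>a \<in> arcs G. int (y a) * (of_bool (head G a \<in> T) - of_bool (tail G a \<in> T))) = 0" (is "?A + ?B = 0")
        using net[of "enc_nat ` T"] unfolding split by (simp add: return_key_def arc_key_def y_def image_iff)
      then have "?B = int (z None) * (of_bool (t \<in> T) - of_bool (s \<in> T))" by (simp add: algebra_simps)
      then have "real_of_int ?B = real_of_int (int (z None) * (of_bool (t \<in> T) - of_bool (s \<in> T)))" by (simp only:)
      then show ?thesis by (simp add: balance_def st_balance_def)
    qed
    show "\<exists>T. s \<in> T \<and> t \<notin> T \<and> blocking y l h T" if "z None < b"
      using st'[of None] that by auto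
    show "\<exists>T. a \<in> inward T \<and> blocking y l h T \<and>
        (t \<in> T \<longrightarrow> s \<notin> T \<longrightarrow> b \<le> z None)" if "a \<in> arcs G" "y a < l a" for a
      using st'[of "Some a"] that by (simp add: y_def)
  qed
qed

lemma scale_arc_cells:
  "scale k u (arc_cells f l h) = arc_cells (\<lambda>a. if f a = 0 then 0 else k) (\<lambda>_. 0) (\<lambda>_. u)"
  by (simp add: scale_def arc_cells_eq)

lemma bound_arc_cells:
  "bound k (arc_cells x l h) =
     arc_cells (\<lambda>_. 0) (\<lambda>a. if x a < k then 0 else 1) (\<lambda>a. if x a = 0 then 0 else 1)"
  by (simp add: bound_def arc_cells_eq)

lemma subtract_arc_cells:
  "subtract (arc_cells x l h) (arc_cells y l' h') = arc_cells (\<lambda>a. if y a = 0 then x a else x a - 1) l h"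
proof -
  have "map2 (\<lambda>r q. with_amt r (if amt q = 0 then amt r else amt r - 1)) (map F as) (map H as) =
      map (\<lambda>a. with_amt (F a) (if amt (H a) = 0 then amt (F a) else amt (F a) - 1)) as" for F H and as :: "nat list"
    by (induction as) auto
  then show ?thesis by (simp add: subtract_def arc_cells_eq with_amt_def)
qed

lemma enc_shown_arc_cells:
  "enc_shown (arc_cells f l h) = enc_list (\<lambda>a. Node (enc_nat a) (enc_rat (of_bool (f a \<noteq> 0)))) es"
  by (simp add: enc_shown_def arc_cells_eq enc_list_map)

lemma balance_cong: "(\<And>a. a \<in> arcs G \<Longrightarrow> f a = g a) \<Longrightarrow> balance f T = balance g T"
  unfolding balance_def by (intro sum.cong) auto

lemma balance_scale: "balance (\<lambda>a. c * f a) T = c * balance f T"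
  by (simp add: balance_def sum_distrib_left mult.assoc)

lemma balance_diff: "balance (\<lambda>a. f a - g a) T = balance f T - balance g T"
  by (simp add: balance_def sum_subtractf[symmetric] left_diff_distrib)

lemma st_balance_scale: "c * st_balance m T = st_balance (c * m) T"
  by (simp add: st_balance_def)

lemma st_balance_diff: "st_balance m T - st_balance n T = st_balance (m - n) T"
  by (simp add: st_balance_def left_diff_distrib)

section \<open>Splitting loads into unit-capacity flows\<close>

text \<open>
  Hoffman's circulation argument: \<open>x\<close> divided by \<open>k\<close> is a fractional flow within
  the bounds, so no cut can obstruct an integral one.
\<close>

lemma peel_step:
  assumes k: "0 < k" and x: "\<forall>a \<in> arcs G. x a \<le> k"
    and bal: "\<forall>T. balance (\<lambda>a. real (x a)) T = st_balance (real k * real m) T"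
    and m: "m \<le> length es + 2"
  shows "\<exists>y. tl (solve (return_cell (enc_nat s) (enc_nat t) m # bound k (arc_cells x l h))) =
       arc_cells y (\<lambda>a. if x a < k then 0 else 1) (\<lambda>a. if x a = 0 then 0 else 1) \<and>
    (\<forall>a \<in> arcs G. y a \<le> 1 \<and> y a \<le> x a \<and> (x a = k \<longrightarrow> y a = 1)) \<and>
    (\<forall>T. balance (\<lambda>a. real (y a)) T = st_balance m T)"
proof -
  note x = bspec[OF x] and bal = spec[OF bal]
  define ll hh where "ll = (\<lambda>a. if x a < k then 0 else 1 :: nat)" and "hh = (\<lambda>a. if x a = 0 then 0 else 1 :: nat)"
  have lh: "\<forall>a \<in> arcs G. ll a \<le> hh a" using k by (auto simp: ll_def hh_def)
  have "(\<Sum>a \<in> arcs G. ll a) \<le> (\<Sum>a \<in> arcs G. 1)" by (intro sum_mono) (simp add: ll_def)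
  then have vio: "m + (\<Sum>a \<in> arcs G. ll a) \<le> 2 * length es + 2" using m by (simp add: card_arcs)
  from solve_return_cell[OF lh vio] obtain n y where
      sol: "solve (return_cell (enc_nat s) (enc_nat t) m # arc_cells (\<lambda>_. 0) ll hh) =
       with_amt (return_cell (enc_nat s) (enc_nat t) m) n # arc_cells y ll hh"
    and nm: "n \<le> m" and yh: "\<forall>a \<in> arcs G. y a \<le> hh a"
    and baly: "\<forall>T. balance (\<lambda>a. real (y a)) T = st_balance n T"
    and cutm: "n < m \<longrightarrow> (\<exists>T. s \<in> T \<and> t \<notin> T \<and> blocking y ll hh T)"
    and cuta: "\<forall>a \<in> arcs G. y a < ll a \<longrightarrow>
      (\<exists>T. a \<in> inward T \<and> blocking y ll hh T \<and> (t \<in> T \<longrightarrow> s \<notin> T \<longrightarrow> m \<le> n))"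
    by (elim exE conjE) (rule that)
  have kl: "k * ll a \<le> x a" "x a \<le> k * hh a" if "a \<in> arcs G" for a using x[OF that] by (auto simp: ll_def hh_def)
  \<comment> \<open>Across a blocked set \<open>y\<close> carries at least as much outwards and at
    most as much inwards as \<open>x\<close> divided by \<open>k\<close>. The last term retains the
    slack of the entering arcs.\<close>
  have cut: "real k * real n * (of_bool (s \<in> T) - of_bool (t \<in> T)) \<ge>
        real k * real m * (of_bool (s \<in> T) - of_bool (t \<in> T)) + real (\<Sum>a \<in> inward T. x a - k * y a)"
    if "blocking y ll hh T" for T
  proof -
    have out: "\<forall>c \<in> outward T. hh c \<le> y c" and inw: "\<forall>c \<in> inward T. y c \<le> ll c"
      using that by (simp_all add: blocking_def)
    have "real (x a) \<le> real k * real (y a)" if "a \<in> outward T" for a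
    proof -
      have "x a \<le> k * hh a" using kl(2) that by (simp add: outward_def)
      also have "\<dots> \<le> k * y a" using out that by (intro mult_le_mono2) blast
      finally show ?thesis by (metis of_nat_mono of_nat_mult)
    qed
    then have o: "(\<Sum>a \<in> outward T. real (x a)) \<le> (\<Sum>a \<in> outward T. real k * real (y a))" by (rule sum_mono)
    have "k * y a \<le> x a" if "a \<in> inward T" for a
    proof -
      have "k * y a \<le> k * ll a" using inw that by (intro mult_le_mono2) blast
      also have "\<dots> \<le> x a" using kl(1) that by (simp add: inward_def)
      finally show ?thesis .
    qed
    then have i: "real (\<Sum>a \<in> inward T. x a - k * y a) =
        (\<Sum>a \<in> inward T. real (x a)) - (\<Sum>a \<in> inward T. real k * real (y a))"
      by (simp add: of_nat_diff sum_subtractf)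
    have "st_balance (real k * real n) T = balance (\<lambda>a. real k * real (y a)) T"
      by (simp add: balance_scale baly st_balance_scale)
    then show ?thesis
      using o i bal[of T] unfolding balance_cut st_balance_def by (simp add: algebra_simps)
  qed
  \<comment> \<open>The value is settled first. Once \<open>n = m\<close>, the terms for the
    terminals in \<open>cut\<close> agree for every \<open>T\<close>, and only the slack
    remains.\<close>
  have nm': "n = m"
  proof (rule ccontr)
    assume "n \<noteq> m"
    then obtain T where T: "s \<in> T" "t \<notin> T" "blocking y ll hh T"
      using cutm nm by auto
    have "real k * real m \<le> real k * real n"
      using cut[OF T(3)] T(1,2) of_nat_0_le_iff[of "\<Sum>a \<in> inward T. x a - k * y a", where 'a = real]
      by (simp del: of_nat_sum of_nat_0_le_iff)
    then show False using k nm \<open>n \<noteq> m\<close> by simp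
  qed
  have ly: "ll a \<le> y a" if a: "a \<in> arcs G" for a
  proof (rule ccontr)
    assume "\<not> ll a \<le> y a"
    then obtain T where T: "a \<in> inward T" "blocking y ll hh T"
      using cuta a by (meson not_le)
    \<comment> \<open>The slack vanishes on all entering arcs, but the violated arc would have slack
      \<open>k\<close>, since \<open>y a = 0\<close> and \<open>x a = k\<close>.\<close>
    have "(\<Sum>a \<in> inward T. x a - k * y a) = 0" using cut[OF T(2)] nm' by (simp del: of_nat_sum)
    then have "x a \<le> k * y a" using T(1) by simp
    moreover have "y a = 0" "x a = k" using \<open>\<not> ll a \<le> y a\<close> x[OF a] by (auto simp: ll_def split: if_splits)
    ultimately show False using k by simp
  qed
  show ?thesis
  proof (intro exI[of _ y] conjI ballI allI impI)
    show "tl (solve (return_cell (enc_nat s) (enc_nat t) m # bound k (arc_cells x l h))) =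
        arc_cells y (\<lambda>a. if x a < k then 0 else 1) (\<lambda>a. if x a = 0 then 0 else 1)"
      using sol by (simp add: bound_arc_cells ll_def hh_def)
    show "balance (\<lambda>a. real (y a)) T = st_balance m T" for T using baly nm' by simp
    fix a assume a: "a \<in> arcs G"
    have "y a \<le> hh a" "ll a \<le> y a" using yh ly a by auto
    then show "y a \<le> 1" "y a \<le> x a" "x a = k \<Longrightarrow> y a = 1" by (auto simp: ll_def hh_def split: if_splits)
  qed
qed

abbreviation enc_flow :: "(nat \<Rightarrow> nat) \<Rightarrow> val" where
  "enc_flow f \<equiv> enc_list (\<lambda>a. Node (enc_nat a) (enc_rat (of_bool (f a \<noteq> 0)))) es"

text \<open>Every arc of full load \<open>Suc k\<close> loses a unit, so the remaining loads fit
  under \<open>k\<close>, and the value drops by \<open>m\<close>. At \<open>k = 0\<close> no load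
  is left, so the flows add up to \<open>x\<close> exactly.\<close>

lemma peel_flows:
  assumes "m \<le> length es + 2"
  shows "\<forall>a \<in> arcs G. x a \<le> k \<Longrightarrow>
    \<forall>T. balance (\<lambda>a. real (x a)) T = st_balance (real k * real m) T \<Longrightarrow>
    \<exists>fs. map enc_shown (peel (enc_nat s) (enc_nat t) k m (arc_cells x l h)) = map enc_flow fs \<and> length fs = k \<and>
      (\<forall>f \<in> set fs. (\<forall>a \<in> arcs G. f a \<le> 1) \<and> (\<forall>T. balance (\<lambda>a. real (f a)) T = st_balance m T)) \<and>
      (\<forall>a \<in> arcs G. (\<Sum>f\<leftarrow>fs. f a) = x a)"
proof (induction k arbitrary: x)
  case 0
  then show ?case by simp
next
  case (Suc k)
  from peel_step[OF zero_less_Suc Suc.prems assms, where l = l and h = h] obtain y where F: "tl (solve (return_cell (enc_nat s) (enc_nat t) m # bound (Suc k) (arc_cells x l h))) =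
       arc_cells y (\<lambda>a. if x a < Suc k then 0 else 1) (\<lambda>a. if x a = 0 then 0 else 1)"
    and y': "\<forall>a \<in> arcs G. y a \<le> 1 \<and> y a \<le> x a \<and> (x a = Suc k \<longrightarrow> y a = 1)"
    and baly: "\<forall>T. balance (\<lambda>a. real (y a)) T = st_balance m T"
    by (elim exE conjE) (rule that)
  note y = bspec[OF y']
  define x' where "x' a = (if y a = 0 then x a else x a - 1)" for a
  have x': "x' a = x a - y a" "x' a \<le> k" "x' a + y a = x a" if "a \<in> arcs G" for a
    using y[OF that] bspec[OF Suc.prems(1) that] by (auto simp: x'_def)
  have "balance (\<lambda>a. real (x' a)) T = st_balance (real k * real m) T" for T
  proof -
    have "balance (\<lambda>a. real (x' a)) T = balance (\<lambda>a. real (x a) - real (y a)) T"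
      using x' y by (intro balance_cong) (simp add: of_nat_diff)
    also have "\<dots> = st_balance (real k * real m) T"
      unfolding balance_diff Suc.prems(2)[rule_format] baly[rule_format] st_balance_diff by (simp add: algebra_simps)
    finally show ?thesis .
  qed
  then have "\<forall>T. balance (\<lambda>a. real (x' a)) T = st_balance (real k * real m) T" ..
  from Suc.IH[OF _ this] x'(2) obtain fs where
    fs: "map enc_shown (peel (enc_nat s) (enc_nat t) k m (arc_cells x' l h)) = map enc_flow fs" "length fs = k"
      "\<forall>f \<in> set fs. (\<forall>a \<in> arcs G. f a \<le> 1) \<and> (\<forall>T. balance (\<lambda>a. real (f a)) T = st_balance m T)"
      "\<forall>a \<in> arcs G. (\<Sum>f\<leftarrow>fs. f a) = x' a" by blast
  have "peel (enc_nat s) (enc_nat t) (Suc k) m (arc_cells x l h) =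
      arc_cells y (\<lambda>a. if x a < Suc k then 0 else 1) (\<lambda>a. if x a = 0 then 0 else 1) #
      peel (enc_nat s) (enc_nat t) k m (arc_cells x' l h)"
    by (simp add: F Let_def subtract_arc_cells x'_def[abs_def])
  then have enc: "map enc_shown (peel (enc_nat s) (enc_nat t) (Suc k) m (arc_cells x l h)) = map enc_flow (y # fs)"
    by (simp add: fs(1) enc_shown_arc_cells)
  have "\<forall>a \<in> arcs G. (\<Sum>f\<leftarrow>y # fs. f a) = x a" using fs(4) x'(3) by (simp add: add.commute)
  moreover have "length (y # fs) = Suc k" using fs(2) by simp
  moreover have "\<forall>f \<in> set (y # fs). (\<forall>a \<in> arcs G. f a \<le> 1) \<and> (\<forall>T. balance (\<lambda>a. real (f a)) T = st_balance m T)"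
    using fs(3) y' baly by simp
  ultimately show ?case using enc by blast
qed

section \<open>Maximum flow and relief of full arcs\<close>

lemma max_flow_cells_spec:
  defines "A \<equiv> map arc_key es"
  shows "\<exists>m f h. max_flow_cells A (enc_nat s) (enc_nat t) =
        with_amt (return_cell (enc_nat s) (enc_nat t) h) m # arc_cells f (\<lambda>_. 0) (\<lambda>_. 1) \<and>
      m \<le> length es \<and> (s = t \<longrightarrow> m = 0) \<and> (\<forall>a \<in> arcs G. f a \<le> 1) \<and>
      (\<forall>T. balance (\<lambda>a. real (f a)) T = st_balance m T) \<and>
      (\<forall>g. st_flow G s t g \<longrightarrow> flow_value G s g \<le> m)"
proof -
  define b where "b = (if s = t then 0 else length es + 1)"
  have lenA: "length A = length es" by (simp add: A_def)
  have b: "(if enc_nat s = enc_nat t then 0 else length A + 1) = b" by (simp add: b_def lenA)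
  have init: "init A = arc_cells (\<lambda>_. 0) (\<lambda>_. 0) (\<lambda>_. 1)"
    by (simp add: init_def A_def arc_cells_eq arc_key_def)
  have pre: "\<forall>a \<in> arcs G. (0::nat) \<le> 1" "b + (\<Sum>a \<in> arcs G. 0) \<le> 2 * length es + 2" by (simp_all add: b_def)
  from solve_return_cell[OF pre] obtain m f where
      sol: "solve (return_cell (enc_nat s) (enc_nat t) b # arc_cells (\<lambda>_. 0) (\<lambda>_. 0) (\<lambda>_. 1)) =
       with_amt (return_cell (enc_nat s) (enc_nat t) b) m # arc_cells f (\<lambda>_. 0) (\<lambda>_. 1)"
    and mb: "m \<le> b" and f': "\<forall>a \<in> arcs G. f a \<le> 1"
    and bal: "\<forall>T. balance (\<lambda>a. real (f a)) T = st_balance m T"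
    and cut: "m < b \<longrightarrow> (\<exists>T. s \<in> T \<and> t \<notin> T \<and> blocking f (\<lambda>_. 0) (\<lambda>_. 1) T)"
    by (elim exE conjE) (rule that)
  note f = bspec[OF f'] and bal = bal[rule_format]
  have cells: "max_flow_cells A (enc_nat s) (enc_nat t) =
      with_amt (return_cell (enc_nat s) (enc_nat t) b) m # arc_cells f (\<lambda>_. 0) (\<lambda>_. 1)"
    unfolding max_flow_cells_def init b by (rule sol)
  have m0: "s = t \<Longrightarrow> m = 0" using mb by (simp add: b_def)
  have mlen: "m \<le> length es"
  proof (cases "s = t")
    case False
    have "real m = (\<Sum>a \<in> outward {s}. real (f a)) - (\<Sum>a \<in> inward {s}. real (f a))"
      using bal[of "{s}"] False by (simp add: balance_cut st_balance_def)
    also have "\<dots> \<le> (\<Sum>a \<in> outward {s}. real (f a))" by (simp add: sum_nonneg)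
    also have "\<dots> \<le> (\<Sum>a \<in> outward {s}. 1)" using f by (intro sum_mono) (auto simp: outward_def)
    also have "\<dots> \<le> real (card (arcs G))" by (auto simp: outward_def intro!: card_mono)
    finally show ?thesis by (simp add: card_arcs)
  qed (simp add: m0)
  have "flow_value G s g \<le> m" if g: "st_flow G s t g" for g
  proof (cases "s = t")
    case True
    then show ?thesis using flow_value_eq_0[OF True g] by simp
  next
    case False
    then obtain T where T: "s \<in> T" "t \<notin> T" "\<forall>c \<in> outward T. 1 \<le> f c" "\<forall>c \<in> inward T. f c \<le> 0"
      using cut mlen by (auto simp: b_def blocking_def)
    have "flow_value G s g \<le> (\<Sum>a \<in> outward T. g a)" by (rule flow_value_le_cut[OF g T(1,2)])
    also have "\<dots> \<le> (\<Sum>a \<in> outward T. real (f a))"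
    proof (rule sum_mono)
      fix a assume a: "a \<in> outward T"
      then have "g a \<le> 1" using g by (simp add: st_flow_def outward_def)
      also have "1 \<le> real (f a)" using T(3) a by fastforce
      finally show "g a \<le> real (f a)" .
    qed
    also have "\<dots> = m" using bal[of T] T by (simp add: balance_cut st_balance_def)
    finally show ?thesis .
  qed
  then show ?thesis using cells mlen m0 f' bal by blast
qed

text \<open>
  An arc that keeps \<open>m + 1\<close> units leaves a set \<open>T\<close> which no arc enters with flow and
  all of whose outgoing arcs carry at least \<open>m\<close> units. As only \<open>m * (m + 1)\<close> units cross
  \<open>T\<close>, it has at most \<open>m\<close> outgoing arcs.
\<close>

lemma relieved_cells:
  assumes f: "\<forall>a \<in> arcs G. f a \<le> 1" and bal: "\<forall>T. balance (\<lambda>a. real (f a)) T = st_balance (real m) T"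
  shows "\<exists>x. solve (scale (Suc m) m (arc_cells f l h)) = arc_cells x (\<lambda>_. 0) (\<lambda>_. m) \<and>
    (\<forall>a \<in> arcs G. x a \<le> Suc m) \<and>
    (\<forall>T. balance (\<lambda>a. real (x a)) T = st_balance (real (Suc m) * real m) T) \<and>
    (\<forall>a \<in> arcs G. \<forall>g. m < x a \<longrightarrow> st_flow G s t g \<longrightarrow> g a = 0 \<longrightarrow> 0 < m \<and> flow_value G s g \<le> real m - 1)"
proof -
  note f = bspec[OF f] and bal = spec[OF bal]
  let ?x = "\<lambda>a. if f a = 0 then 0 else Suc m"
  \<comment> \<open>Each arc exceeds the new upper bound by at most one unit.\<close>
  have "(\<Sum>a \<in> arcs G. (0 - ?x a) + (?x a - m)) \<le> (\<Sum>a \<in> arcs G. 1)" by (intro sum_mono) simp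
  then have vio: "(\<Sum>a \<in> arcs G. (0 - ?x a) + (?x a - m)) \<le> 2 * length es" by (simp add: card_arcs)
  have pre: "\<forall>a \<in> arcs G. 0 \<le> m" by simp
  from solve_arc_cells[OF pre vio] obtain x where
      sol: "solve (arc_cells ?x (\<lambda>_. 0) (\<lambda>_. m)) = arc_cells x (\<lambda>_. 0) (\<lambda>_. m)"
    and bd: "\<forall>a \<in> arcs G. x a \<le> max m (?x a)"
    and bx: "\<forall>T. balance (\<lambda>a. real (x a)) T = balance (\<lambda>a. real (?x a)) T"
    and cut: "\<forall>a \<in> arcs G. 0 \<le> x a \<longrightarrow> m < x a \<longrightarrow>
      (\<exists>T. a \<in> outward T \<and> blocking x (\<lambda>_. 0) (\<lambda>_. m) T)"
    by (elim exE conjE) (rule that)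
  note bx = bx[rule_format]
  have balx: "balance (\<lambda>a. real (x a)) T = st_balance (real (Suc m) * real m) T" for T
  proof -
    have "real (?x a) = real (Suc m) * real (f a)" if "a \<in> arcs G" for a using f[OF that] by (cases "f a") auto
    then have "balance (\<lambda>a. real (?x a)) T = balance (\<lambda>a. real (Suc m) * real (f a)) T" by (rule balance_cong)
    then show ?thesis unfolding bx balance_scale bal st_balance_scale .
  qed
  have crit: "0 < m \<and> flow_value G s g \<le> real m - 1"
    if a: "a \<in> arcs G" "m < x a" and g: "st_flow G s t g" "g a = 0" for a g
  proof -
    obtain T where T: "a \<in> outward T" "\<forall>b \<in> outward T. m \<le> x b" "\<forall>b \<in> inward T. x b \<le> 0"
      using cut a unfolding blocking_def by blast
    have split: "(\<Sum>b \<in> outward T. F b) = F a + (\<Sum>b \<in> outward T - {a}. F b)" for F :: "nat \<Rightarrow> real"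
      using T(1) by (intro sum.remove) auto
    have card: "real (card (outward T)) = real (card (outward T - {a})) + 1"
      using card_Suc_Diff1[OF finite_outward T(1)] by linarith
    have "real m * real (card (outward T - {a})) \<le> (\<Sum>b \<in> outward T - {a}. real (x b))"
      using T(2) sum_bounded_below[of "outward T - {a}" "real m" "\<lambda>b. real (x b)"] by (simp add: mult.commute)
    \<comment> \<open>The extra unit is the one by which \<open>a\<close> exceeds
      \<open>m\<close>.\<close>
    then have low: "real m * real (card (outward T)) + 1 \<le> (\<Sum>b \<in> outward T. real (x b))"
      unfolding split[of "\<lambda>b. real (x b)"] card using a(2) by (simp add: algebra_simps)
    have "(\<Sum>b \<in> outward T. real (x b)) = - st_balance (real (Suc m) * real m) T"
      using balx[of T] T(3) by (simp add: balance_cut)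
    then have eq: "(\<Sum>b \<in> outward T. real (x b)) = real (Suc m) * real m * (of_bool (s \<in> T) - of_bool (t \<in> T))"
      by (simp add: st_balance_def algebra_simps)
    \<comment> \<open>The certificate only concerns the arc \<open>a\<close>. That it separates
      \<open>s\<close> from \<open>t\<close>, and that \<open>m\<close> is positive, follows from
      the positive load that leaves it.\<close>
    have "0 < real (Suc m) * real m * (of_bool (s \<in> T) - of_bool (t \<in> T))"
      using low unfolding eq by (smt (verit) mult_nonneg_nonneg of_nat_0_le_iff)
    moreover have "0 \<le> (1 + real m) * real m" by simp
    ultimately have st: "s \<in> T" "t \<notin> T" and m: "0 < m"
      by (auto simp: of_bool_def zero_less_mult_iff split: if_splits)
    have "real m * real (card (outward T)) < real m * (real m + 1)" using low st unfolding eq by (simp add: algebra_simps)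
    then have "card (outward T) \<le> m" using m by (simp add: mult_less_cancel_left)
    \<comment> \<open>A flow that avoids \<open>a\<close> has at most \<open>m - 1\<close> arcs of
      the cut left.\<close>
    then have "real (card (outward T - {a})) \<le> real m - 1" using card by simp
    moreover have "(\<Sum>b \<in> outward T - {a}. g b) \<le> (\<Sum>b \<in> outward T - {a}. 1)"
      using g(1) by (intro sum_mono) (auto simp: st_flow_def outward_def)
    ultimately have "(\<Sum>b \<in> outward T. g b) \<le> real m - 1" unfolding split[of g] g(2) by simp
    then show ?thesis using flow_value_le_cut[OF g(1) st] m by simp
  qed
  show ?thesis
  proof (intro exI[of _ x] conjI ballI allI impI)
    show "solve (scale (Suc m) m (arc_cells f l h)) = arc_cells x (\<lambda>_. 0) (\<lambda>_. m)"
      unfolding scale_arc_cells by (rule sol)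
    show "x a \<le> Suc m" if "a \<in> arcs G" for a using bd that by (auto split: if_splits)
    show "balance (\<lambda>a. real (x a)) T = st_balance (real (Suc m) * real m) T" for T by (rule balx)
    show "0 < m" "flow_value G s g \<le> real m - 1"
      if "a \<in> arcs G" "m < x a" "st_flow G s t g" "g a = 0" for a g using crit that by blast+
  qed
qed

section \<open>The family of flows\<close>

definition rat_flow :: "(nat \<Rightarrow> nat) \<Rightarrow> nat \<Rightarrow> rat" where
  "rat_flow f a = (if a \<in> arcs G then of_nat (f a) else 0)"

lemma rat_flow_st_flow:
  assumes "\<forall>a \<in> arcs G. f a \<le> 1" "\<forall>T. balance (\<lambda>a. real (f a)) T = st_balance m T" "s = t \<Longrightarrow> m = 0"
  shows "st_flow G s t (real_flow (rat_flow f))" "flow_value G s (real_flow (rat_flow f)) = m"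
proof -
  have r: "real_flow (rat_flow f) a = (if a \<in> arcs G then real (f a) else 0)" for a
    by (simp add: real_flow_def rat_flow_def)
  have b: "balance (real_flow (rat_flow f)) T = st_balance m T" for T
    using balance_cong[of "real_flow (rat_flow f)" "\<lambda>a. real (f a)" T] assms(2) by (simp add: r)
  show "st_flow G s t (real_flow (rat_flow f))" "flow_value G s (real_flow (rat_flow f)) = m"
    by (rule balance_flow[OF b]; use assms(1,3) in \<open>simp add: r\<close>)+
qed

lemma enc_flows_rat_flow:
  assumes "\<forall>f \<in> set fs. \<forall>a \<in> arcs G. f a \<le> 1"
  shows "enc_flows es (map rat_flow fs) = enc_list enc_flow fs"
proof -
  have "(of_nat (f a) :: rat) = of_bool (f a \<noteq> 0)" if "f \<in> set fs" "a \<in> arcs G" for f a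
  proof -
    have "f a \<le> 1" using assms that by blast
    then show ?thesis by (cases "f a") auto
  qed
  then show ?thesis unfolding enc_flows_def enc_list_map by (intro enc_list_cong) (simp add: rat_flow_def)
qed

lemma flow_family_spec:
  defines "A \<equiv> map arc_key es"
  assumes g: "st_max_flow G s t g"
  shows "\<exists>m B. amt (hd (max_flow_cells A (enc_nat s) (enc_nat t))) = m \<and> m \<le> length es \<and> flow_value G s g = real m \<and>
    enc_list enc_shown (flow_family A (enc_nat s) (enc_nat t)) = enc_flows es B \<and> length B = 2 * m + 1 \<and>
    (\<forall>f \<in> set B. st_flow G s t (real_flow f)) \<and>
    (\<forall>e \<in> arcs G. \<exists>f \<in> set B. st_max_flow (del_arc e) s t (real_flow f))"
proof -
  obtain m f h where F: "max_flow_cells A (enc_nat s) (enc_nat t) =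
        with_amt (return_cell (enc_nat s) (enc_nat t) h) m # arc_cells f (\<lambda>_. 0) (\<lambda>_. 1)"
    and m: "m \<le> length es" and m0: "s = t \<longrightarrow> m = 0" and f: "\<forall>a \<in> arcs G. f a \<le> 1"
    and bal: "\<forall>T. balance (\<lambda>a. real (f a)) T = st_balance m T"
    and max: "\<forall>g. st_flow G s t g \<longrightarrow> flow_value G s g \<le> m"
    using max_flow_cells_spec[folded A_def] by (elim exE conjE) (rule that)
  obtain x where X: "solve (scale (Suc m) m (arc_cells f (\<lambda>_. 0) (\<lambda>_. 1))) = arc_cells x (\<lambda>_. 0) (\<lambda>_. m)"
    and x: "\<forall>a \<in> arcs G. x a \<le> Suc m"
    and balx: "\<forall>T. balance (\<lambda>a. real (x a)) T = st_balance (real (Suc m) * real m) T"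
    and crit: "\<forall>a \<in> arcs G. \<forall>g. m < x a \<longrightarrow> st_flow G s t g \<longrightarrow> g a = 0 \<longrightarrow> 0 < m \<and> flow_value G s g \<le> real m - 1"
    using relieved_cells[OF f bal, where l = "\<lambda>_. 0" and h = "\<lambda>_. 1"]
    by (elim exE conjE) (rule that)
  have "m \<le> length es + 2" using m by simp
  from peel_flows[OF this x balx, where l = "\<lambda>_. 0" and h = "\<lambda>_. m"] obtain fs where
    fs: "map enc_shown (peel (enc_nat s) (enc_nat t) (Suc m) m (arc_cells x (\<lambda>_. 0) (\<lambda>_. m))) = map enc_flow fs"
      "length fs = Suc m"
      "\<forall>f \<in> set fs. (\<forall>a \<in> arcs G. f a \<le> 1) \<and> (\<forall>T. balance (\<lambda>a. real (f a)) T = st_balance m T)"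
      "\<forall>a \<in> arcs G. (\<Sum>f\<leftarrow>fs. f a) = x a" by (elim exE conjE) (rule that)
  let ?x = "\<lambda>a. if f a = 0 then 0 else m - 1"
  have "balance (\<lambda>a. real (?x a)) T = st_balance (real m * real (m - 1)) T" for T
  proof -
    have "real (?x a) = real (m - 1) * real (f a)" if "a \<in> arcs G" for a using bspec[OF f that] by (cases "f a") auto
    then have "balance (\<lambda>a. real (?x a)) T = balance (\<lambda>a. real (m - 1) * real (f a)) T" by (rule balance_cong)
    then show ?thesis unfolding balance_scale bal[rule_format] st_balance_scale by (simp add: mult.commute)
  qed
  then have balx': "\<forall>T. balance (\<lambda>a. real (?x a)) T = st_balance (real m * real (m - 1)) T" ..
  have "m - 1 \<le> length es + 2" "\<forall>a \<in> arcs G. ?x a \<le> m" using m by auto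
  from peel_flows[OF this balx', where l = "\<lambda>_. 0" and h = "\<lambda>_. 0"] obtain fs' where
    fs': "map enc_shown (peel (enc_nat s) (enc_nat t) m (m - 1) (arc_cells ?x (\<lambda>_. 0) (\<lambda>_. 0))) = map enc_flow fs'"
      "length fs' = m"
      "\<forall>f \<in> set fs'. (\<forall>a \<in> arcs G. f a \<le> 1) \<and> (\<forall>T. balance (\<lambda>a. real (f a)) T = st_balance (real (m - 1)) T)"
      "\<forall>a \<in> arcs G. (\<Sum>f\<leftarrow>fs'. f a) = ?x a" by (elim exE conjE) (rule that)
  have flow1: "st_flow G s t (real_flow (rat_flow q))" "flow_value G s (real_flow (rat_flow q)) = m"
    if "q \<in> set fs" for q
    using rat_flow_st_flow[of q "real m"] fs(3) that m0 by auto
  have flow2: "st_flow G s t (real_flow (rat_flow q))" "flow_value G s (real_flow (rat_flow q)) = real (m - 1)"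
    if "q \<in> set fs'" for q
    using rat_flow_st_flow[of q "real (m - 1)"] fs'(3) that m0 by auto
  \<comment> \<open>The first list is nonempty even for \<open>m = 0\<close>, so it contains a flow
    that attains \<open>m\<close> and identifies the given maximum value.\<close>
  obtain q where "q \<in> set fs" using fs(2) by (cases fs) auto
  then have "real m \<le> flow_value G s g" using g flow1[of q] by (auto simp: st_max_flow_def)
  then have gm: "flow_value G s g = real m" using g max by (auto simp: st_max_flow_def intro: antisym)
  have best: "st_max_flow (del_arc e) s t (real_flow (rat_flow q))"
    if "e \<in> arcs G" "q e = 0" "st_flow G s t (real_flow (rat_flow q))"
      "\<And>g. st_flow G s t g \<Longrightarrow> g e = 0 \<Longrightarrow> flow_value G s g \<le> flow_value G s (real_flow (rat_flow q))" for e q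
  proof -
    have "real_flow (rat_flow q) e = 0" using that(2) by (simp add: real_flow_def rat_flow_def)
    then show ?thesis using that(3,4) by (auto simp: st_max_flow_def del_arc_flow)
  qed
  have "\<exists>f \<in> set (map rat_flow (fs @ fs')). st_max_flow (del_arc e) s t (real_flow f)" if e: "e \<in> arcs G" for e
  proof (cases "x e \<le> m")
    case True
    then have "(\<Sum>f\<leftarrow>fs. f e) < length fs" using fs(2,4) e by simp
    from sum_list_zero_member[OF this] obtain q where q: "q \<in> set fs" "q e = 0" by (rule bexE)
    have "st_max_flow (del_arc e) s t (real_flow (rat_flow q))"
      using flow1[OF q(1)] max by (intro best[of e q, OF e q(2)]) simp_all
    then show ?thesis using q(1) by auto
  next
    case False
    \<comment> \<open>The zero flow avoids \<open>e\<close>, so \<open>crit\<close> applies to it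
      and gives \<open>0 < m\<close>. Then the load of at most \<open>m - 1\<close> is below the
      number \<open>m\<close> of flows in the second list.\<close>
    have "st_flow G s t (\<lambda>_. 0)" by (simp add: st_flow_def)
    then have "0 < m" using spec[OF bspec[OF crit e], of "\<lambda>_. 0"] False by simp
    then have "(\<Sum>f\<leftarrow>fs'. f e) < length fs'" using fs'(2,4) e by simp
    from sum_list_zero_member[OF this] obtain q where q: "q \<in> set fs'" "q e = 0" by (rule bexE)
    have le: "flow_value G s g' \<le> flow_value G s (real_flow (rat_flow q))" if "st_flow G s t g'" "g' e = 0" for g'
    proof -
      have "flow_value G s g' \<le> real m - 1" using spec[OF bspec[OF crit e], of g'] False that by simp
      then show ?thesis using flow2(2)[OF q(1)] \<open>0 < m\<close> by (simp add: of_nat_diff)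
    qed
    have "st_max_flow (del_arc e) s t (real_flow (rat_flow q))"
      by (rule best[of e q, OF e q(2) flow2(1)[OF q(1)] le])
    then show ?thesis using q(1) by auto
  qed
  moreover have "\<forall>f \<in> set (map rat_flow (fs @ fs')). st_flow G s t (real_flow f)" using flow1 flow2 by auto
  moreover have "enc_list enc_shown (flow_family A (enc_nat s) (enc_nat t)) = enc_flows es (map rat_flow (fs @ fs'))"
  proof -
    have map_eq: "enc_list enc_shown Fs = enc_list enc_flow qs" if "map enc_shown Fs = map enc_flow qs" for Fs qs
      using arg_cong[OF that, of "enc_list (\<lambda>v. v)"] by (simp add: enc_list_map)
    have fam: "flow_family A (enc_nat s) (enc_nat t) =
        peel (enc_nat s) (enc_nat t) (Suc m) m (arc_cells x (\<lambda>_. 0) (\<lambda>_. m)) @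
        peel (enc_nat s) (enc_nat t) m (m - 1) (arc_cells ?x (\<lambda>_. 0) (\<lambda>_. 0))"
      unfolding flow_family_def F Let_def list.sel with_amt_sel X unfolding scale_arc_cells ..
    have "enc_list enc_shown (flow_family A (enc_nat s) (enc_nat t)) = enc_list enc_flow (fs @ fs')"
      unfolding fam by (rule map_eq) (simp only: map_append fs(1) fs'(1))
    moreover have "\<forall>f \<in> set fs. \<forall>a \<in> arcs G. f a \<le> 1" "\<forall>f \<in> set fs'. \<forall>a \<in> arcs G. f a \<le> 1"
      using fs(3) fs'(3) by blast+
    ultimately show ?thesis using enc_flows_rat_flow[of "fs @ fs'"] by (simp add: ball_Un)
  qed
  moreover have "length (map rat_flow (fs @ fs')) = 2 * m + 1" using fs(2) fs'(2) by simp
  moreover have "amt (hd (max_flow_cells A (enc_nat s) (enc_nat t))) = m" by (simp add: F)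
  ultimately show ?thesis using m gm
    by (intro exI[of _ m] exI[of _ "map rat_flow (fs @ fs')"] conjI) simp_all
qed

end

theorem theorem7:
  shows "\<exists>(P :: program) (q :: nat poly).
    \<forall>(G :: (nat, nat) pre_digraph) vs es s t g (lam :: real).
      fin_digraph G \<and> enumerates vs (verts G) \<and> enumerates es (arcs G) \<and>
      s \<in> verts G \<and> t \<in> verts G \<and>
      st_max_flow G s t g \<and> flow_value G s g = lam \<longrightarrow>
      (\<exists>B :: (nat \<Rightarrow> rat) list.
         computes_within P (enc_input G vs es s t) (enc_flows es B)
           (poly q (val_size (enc_input G vs es s t))) \<and>
         real (length B) = 2 * lam + 1 \<and>
         (\<forall>f \<in> set B. st_flow G s t (real_flow f)) \<and>
         (\<forall>e \<in> arcs G. \<exists>f \<in> set B. st_max_flow (pre_digraph.del_arc G e) s t (real_flow f)))"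
proof -
  obtain q :: "nat poly" where q: "\<forall>n. main_bound (n + 3) \<le> poly q n"
    using poly_bounded_main_bound unfolding poly_bounded_def by blast
  show ?thesis
  proof (intro exI[of _ "(prog, main_expr)"] exI[of _ q] allI impI, elim conjE)
    fix G :: "(nat, nat) pre_digraph" and vs es s t g and lam :: real
    assume G: "fin_digraph G" "enumerates es (arcs G)" "s \<in> verts G" "t \<in> verts G"
      and g: "st_max_flow G s t g" "flow_value G s g = lam"
    interpret network G es s t using G by (simp add: network_def network_axioms_def)
    let ?A = "map arc_key es" and ?in = "enc_input G vs es s t"
    let ?N = "val_size ?in + 3"
    from flow_family_spec[OF g(1)] obtain m B where
      m: "amt (hd (max_flow_cells ?A (enc_nat s) (enc_nat t))) = m" "m \<le> length es" "flow_value G s g = real m"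
      and enc: "enc_list enc_shown (flow_family ?A (enc_nat s) (enc_nat t)) = enc_flows es B"
      and B: "length B = 2 * m + 1" "\<forall>f \<in> set B. st_flow G s t (real_flow f)"
        "\<forall>e \<in> arcs G. \<exists>f \<in> set B. st_max_flow (del_arc e) s t (real_flow f)"
      by (elim exE conjE) (rule that)
    let ?arcs = "enc_list (\<lambda>a. Node (enc_nat a) (Node (enc_nat (tail G a)) (enc_nat (head G a)))) es"
    have arcs: "enc_list (\<lambda>(a, u, v). Node a (Node u v)) ?A = ?arcs"
      by (simp add: enc_list_map arc_key_def)
    have size_arcs: "val_size ?arcs \<le> val_size ?in" by (simp add: enc_input_def)
    have "\<exists>c \<le> main_bound ?N. eval prog
        [Node (enc_list enc_nat vs) (Node (enc_list (\<lambda>(a, u, v). Node a (Node u v)) ?A) (Node (enc_nat s) (enc_nat t)))]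
        main_expr (enc_list enc_shown (flow_family ?A (enc_nat s) (enc_nat t))) c"
    proof (rule main_eval)
      have len: "length es < val_size ?in" using length_less_val_size[of es] size_arcs less_le_trans by blast
      then show "length ?A + 2 \<le> ?N" by simp
      show "amt (hd (max_flow_cells ?A (enc_nat s) (enc_nat t))) < ?N" using m(1,2) len by simp
      show "val_size (enc_nat s) \<le> ?N" "val_size (enc_nat t) \<le> ?N" by (simp_all add: enc_input_def)
      fix a u v assume "(a, u, v) \<in> set ?A"
      then obtain i where "i \<in> set es" "(a, u, v) = arc_key i" by auto
      then have "val_size (Node a (Node u v)) \<le> val_size ?arcs"
        using val_size_member[of i es "\<lambda>a. Node (enc_nat a) (Node (enc_nat (tail G a)) (enc_nat (head G a)))"]
        by (simp add: arc_key_def)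
      then show "val_size a \<le> ?N \<and> val_size u \<le> ?N \<and> val_size v \<le> ?N" using size_arcs by simp
    qed simp
    then have "\<exists>c \<le> main_bound ?N. eval prog [?in] main_expr (enc_flows es B) c"
      unfolding arcs enc enc_input_def .
    then have "computes_within (prog, main_expr) ?in (enc_flows es B) (poly q (val_size ?in))"
      unfolding computes_within_def using q order.trans by (metis fst_conv snd_conv)
    moreover have "real (length B) = 2 * lam + 1" using B(1) m(3) g(2) by simp
    ultimately show "\<exists>B. computes_within (prog, main_expr) ?in (enc_flows es B) (poly q (val_size ?in)) \<and>
        real (length B) = 2 * lam + 1 \<and> (\<forall>f \<in> set B. st_flow G s t (real_flow f)) \<and>
        (\<forall>e \<in> arcs G. \<exists>f \<in> set B. st_max_flow (del_arc e) s t (real_flow f))"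
      using B(2,3) by blast
  qed
qed

end
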